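(* Let $k\geq 2$ be an integer, and let $G$ be a graph of order $n$ with minimum degree $\delta\geq 1$. Suppose that for every independent set $\{x_1,x_2,\ldots,x_{\lfloor(k+\frac{1}{2})\delta\rfloor+1}\}$ of $\lfloor(k+\frac{1}{2})\delta\rfloor+1$ vertices of $G$, $$\max\{d_G(x_1),d_G(x_2),\ldots,d_G(x_{\lfloor(k+\frac{1}{2})\delta\rfloor+1})\}\geq\frac{2n}{2k+3}.$$ Then $G$ has a $\{K_{1,1},K_{1,2},\ldots,K_{1,k},\mathcal{T}(2k+1)\}$-factor.
   Context: All graphs are finite, undirected, without loops or multiple edges; $d_G(x)$ is the degree of $x$ in $G$. $K_{1,j}$ denotes the star with $j$ leaves. For a set $\mathcal{H}$ of connected graphs, an $\mathcal{H}$-factor of $G$ is a spanning subgraph of $G$ each of whose connected components is isomorphic to an element of $\mathcal{H}$. The family $\mathcal{T}(2k+1)$ ($k\geq2$) is defined as follows. For a tree $T$, $Leaf(T)$ is its set of leaves. Let $R$ be a tree such that for every $x\in V(R)\setminus Leaf(R)$: (a) $d_{R-Leaf(R)}(x)\in\{1,3,\ldots,2k+1\}$, and (b) $2\cdot(\text{number of leaves of } R \text{ adjacent to } x)+d_{R-Leaf(R)}(x)\leq 2k+1$. From such $R$ build a tree $T_R$ by (c) inserting a new vertex of degree 2 into each edge of $R-Leaf(R)$, and (d) for every vertex $x$ of $R-Leaf(R)$ with $d_{R-Leaf(R)}(x)=2r+1<2k+1$, attaching $k-r-(\text{number of leaves of } R \text{ adjacent to } x)$ new pendant edges to $x$. Then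 $\mathcal{T}(2k+1)$ is the set of all trees $T_R$ over all trees $R$ satisfying (a) and (b). A $\{K_{1,1},\ldots,K_{1,k},\mathcal{T}(2k+1)\}$-factor is an $\mathcal{H}$-factor with $\mathcal{H}=\{K_{1,1},\ldots,K_{1,k}\}\cup\mathcal{T}(2k+1)$. *)

theory Defs
  imports Complex_Main "HOL-Library.Ramsey"
begin

text \<open>
  Edges are two-element sets of vertices, as in \<open>HOL-Library.Ramsey\<close>, whose \<open>indep\<close> is used for
  independent sets.
\<close>

record 'a ugraph =
  verts :: "'a set"
  edges :: "'a set set"

definition simple_graph :: "'a ugraph \<Rightarrow> bool" where
  "simple_graph G \<longleftrightarrow> finite (verts G) \<and> (\<forall>e\<in>edges G. e \<subseteq> verts G \<and> card e = 2)"

definition degree :: "'a ugraph \<Rightarrow> 'a \<Rightarrow> nat" where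
  "degree G x = card {e \<in> edges G. x \<in> e}"

text \<open>Only meaningful for graphs with at least one vertex.\<close>
definition min_degree :: "'a ugraph \<Rightarrow> nat" where
  "min_degree G = Min (degree G ` verts G)"

definition independent_set :: "'a ugraph \<Rightarrow> 'a set \<Rightarrow> bool" where
  "independent_set G S \<longleftrightarrow> S \<subseteq> verts G \<and> indep S (edges G)"

definition induced :: "'a ugraph \<Rightarrow> 'a set \<Rightarrow> 'a ugraph" where
  "induced G U = \<lparr>verts = U, edges = {e \<in> edges G. e \<subseteq> U}\<rparr>"

definition graph_iso :: "'a ugraph \<Rightarrow> 'b ugraph \<Rightarrow> bool" where
  "graph_iso G H \<longleftrightarrow> (\<exists>f. bij_betw f (verts G) (verts H) \<and>
     (\<forall>x\<in>verts G. \<forall>y\<in>verts G. {x, y} \<in> edges G \<longleftrightarrow> {f x, f y} \<in> edges H))"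

definition reachable :: "'a ugraph \<Rightarrow> 'a \<Rightarrow> 'a \<Rightarrow> bool" where
  "reachable G x y \<longleftrightarrow> (x, y) \<in> {(u, v). {u, v} \<in> edges G}\<^sup>*"

definition connected_graph :: "'a ugraph \<Rightarrow> bool" where
  "connected_graph G \<longleftrightarrow> verts G \<noteq> {} \<and> (\<forall>x\<in>verts G. \<forall>y\<in>verts G. reachable G x y)"

definition components :: "'a ugraph \<Rightarrow> 'a ugraph set" where
  "components G = {induced G {y \<in> verts G. reachable G x y} | x. x \<in> verts G}"

definition spanning_subgraph :: "'a ugraph \<Rightarrow> 'a ugraph \<Rightarrow> bool" where
  "spanning_subgraph F G \<longleftrightarrow> verts F = verts G \<and> edges F \<subseteq> edges G"

definition is_cycle :: "'a ugraph \<Rightarrow> 'a list \<Rightarrow> bool" where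
  "is_cycle G p \<longleftrightarrow> 3 \<le> length p \<and> distinct p \<and>
     (\<forall>i. Suc i < length p \<longrightarrow> {p ! i, p ! Suc i} \<in> edges G) \<and> {last p, hd p} \<in> edges G"

definition tree :: "'a ugraph \<Rightarrow> bool" where
  "tree T \<longleftrightarrow> simple_graph T \<and> connected_graph T \<and> (\<nexists>p. is_cycle T p)"

definition leaves :: "'a ugraph \<Rightarrow> 'a set" where
  "leaves T = {x \<in> verts T. degree T x = 1}"

definition is_factor :: "'b ugraph set \<Rightarrow> 'a ugraph \<Rightarrow> 'a ugraph \<Rightarrow> bool" where
  "is_factor \<H> G F \<longleftrightarrow> spanning_subgraph F G \<and>
     (\<forall>C\<in>components F. \<exists>H\<in>\<H>. graph_iso C H)"

text \<open>The star \<open>K\<^bsub>1,j\<^esub>\<close>, with centre \<open>0\<close>.\<close>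
definition star :: "nat \<Rightarrow> nat ugraph" where
  "star j = \<lparr>verts = {0..j}, edges = {{0, i} | i. 1 \<le> i \<and> i \<le> j}\<rparr>"

text \<open>\<open>core R\<close> is \<open>R - Leaf(R)\<close>. It is empty for \<open>R = K\<^sub>2\<close>.\<close>
definition core :: "'a ugraph \<Rightarrow> 'a ugraph" where
  "core R = induced R (verts R - leaves R)"

definition adjacent_leaves :: "'a ugraph \<Rightarrow> 'a \<Rightarrow> nat" where
  "adjacent_leaves R x = card {y \<in> leaves R. {x, y} \<in> edges R}"

text \<open>The conditions on the trees \<open>R\<close> from which \<open>\<T>(2k+1)\<close> is built.\<close>
definition admissible :: "nat \<Rightarrow> 'a ugraph \<Rightarrow> bool" where
  "admissible k R \<longleftrightarrow> tree R \<and>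
     (\<forall>x \<in> verts R - leaves R.
        degree (core R) x \<in> {d. odd d \<and> 1 \<le> d \<and> d \<le> 2 * k + 1} \<and>
        2 * adjacent_leaves R x + degree (core R) x \<le> 2 * k + 1)"

text \<open>
  The vertices of \<open>T\<^sub>R\<close>: those of \<open>R\<close>, one subdivision vertex \<open>Mid e\<close> for each edge \<open>e\<close> of
  \<open>R - Leaf(R)\<close>, and the ends \<open>Pend x i\<close> of the new pendant edges attached to \<open>x\<close>.
\<close>
datatype 'a tvertex = Orig 'a | Mid "'a set" | Pend 'a nat

text \<open>
  The natural-number subtraction never truncates when \<open>R\<close> is admissible: the second condition gives
  \<open>r + adjacent_leaves R x \<le> k\<close>.
\<close>
definition new_pendants :: "nat \<Rightarrow> 'a ugraph \<Rightarrow> ('a \<times> nat) set" where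
  "new_pendants k R = {(x, i). x \<in> verts (core R) \<and>
     (\<exists>r. degree (core R) x = 2 * r + 1 \<and> 2 * r + 1 < 2 * k + 1 \<and>
          i < k - r - adjacent_leaves R x)}"

definition tree_T :: "nat \<Rightarrow> 'a ugraph \<Rightarrow> 'a tvertex ugraph" where
  "tree_T k R =
     \<lparr>verts = Orig ` verts R \<union> Mid ` edges (core R) \<union> {Pend x i | x i. (x, i) \<in> new_pendants k R},
      edges = {Orig ` e | e. e \<in> edges R - edges (core R)}
            \<union> {{Orig x, Mid e} | x e. e \<in> edges (core R) \<and> x \<in> e}
            \<union> {{Orig x, Pend x i} | x i. (x, i) \<in> new_pendants k R}\<rparr>"

text \<open>
  \<open>family_T k\<close> is \<open>\<T>(2k+1)\<close>, up to isomorphism. All trees are finite, so vertices in \<open>nat\<close>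
  represent every isomorphism type, both for \<open>R\<close> and for \<open>T\<^sub>R\<close>.
\<close>
definition family_T :: "nat \<Rightarrow> nat ugraph set" where
  "family_T k = {T. simple_graph T \<and>
     (\<exists>R :: nat ugraph. admissible k R \<and> graph_iso T (tree_T k R))}"

end

theory Submission
  imports Defs "HOL-Combinatorics.Cycles"
begin

text \<open>
  The degree condition forces \<open>2 iso(G - S) \<le> (2k + 1) |S|\<close> for every \<open>S\<close>, and this alone
  suffices for the factor. Choose \<open>S\<close> to maximise \<open>iso(G - S) - |S|\<close>, and let \<open>I\<close> be the set of
  vertices that become isolated. By maximality the remaining vertices satisfy Hall's condition,
  so some permutation moves each of them along an edge; its cycles split into copies of
  \<open>K\<^sub>1\<^sub>,\<^sub>1\<close> and \<open>K\<^sub>1\<^sub>,\<^sub>2\<close>. For \<open>S \<union> I\<close>, Hall's theorem assigns to each \<open>i \<in> I\<close> two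
  neighbours in \<open>S\<close>, possibly equal, such that each \<open>s \<in> S\<close> is used between \<open>2\<close> and \<open>2k + 1\<close>
  times. View \<open>I\<close> as the edge set of a multigraph on \<open>S\<close> with these degrees and minimise the
  number of non-loops. Turning a single edge into a loop shows that the ends of a non-loop both have
  degree \<open>2\<close> or both have degree \<open>2k + 1\<close>; turning the edges of a cycle into loops shows that the
  non-loops form a forest, and a similar exchange excludes degree \<open>2\<close>. Hence every component
  is either a single \<open>s\<close> with between \<open>1\<close> and \<open>k\<close> loops, which is a star, or a tree with all degrees
  equal to \<open>2k + 1\<close> in which a vertex with \<open>2r + 1\<close> non-loops has \<open>k - r\<close> loops: read non-loops as
  subdivision vertices and loops as pendant vertices, this is a member of \<open>\<T>(2k+1)\<close>.
\<close>

section \<open>Hall's theorem\<close>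

text \<open>Halmos-Vaughan induction on \<open>card A\<close>. If a nonempty proper subset
  \<open>B\<close> is tight, match \<open>B\<close> by itself and the rest outside its
  neighbourhood. Otherwise every nonempty proper subset has a spare neighbour, so any
  \<open>x\<close> may take any \<open>y\<close> in \<open>N x\<close>.\<close>

theorem hall:
  fixes A :: "'a set" and N :: "'a \<Rightarrow> 'b set"
  assumes "finite A" and "\<And>x. x \<in> A \<Longrightarrow> finite (N x)"
    and "\<And>X. X \<subseteq> A \<Longrightarrow> card X \<le> card (\<Union>(N ` X))"
  shows "\<exists>f. inj_on f A \<and> (\<forall>x\<in>A. f x \<in> N x)"
  using assms
proof (induction "card A" arbitrary: A N rule: less_induct)
  case less
  note fin = less.prems(1) and finN = less.prems(2) and cond = less.prems(3)
  have finU: "finite (\<Union>(N ` X))" if "X \<subseteq> A" for X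
    using that fin finN by (meson finite_UN finite_subset subsetD)
  consider "A = {}" | (tight) B where "B \<subset> A" "B \<noteq> {}" "card (\<Union>(N ` B)) = card B"
    | (loose) "A \<noteq> {}" "\<And>B. B \<subset> A \<Longrightarrow> B \<noteq> {} \<Longrightarrow> card B < card (\<Union>(N ` B))"
    using cond by (metis le_neq_implies_less psubset_imp_subset)
  then show ?case
  proof cases
    case tight
    have finB: "finite B" using tight(1) fin by (meson finite_subset psubset_imp_subset)
    \<comment> \<open>Hall's condition for \<open>N'\<close> and \<open>X\<close> comes from the
      condition for \<open>X\<close> together with \<open>B\<close>: both sides then drop by exactly
      \<open>card B\<close>.\<close>
    define N' where "N' x = N x - \<Union>(N ` B)" for x
    have "card B < card A" using tight(1) fin by (simp add: psubset_card_mono)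
    then obtain f where f: "inj_on f B" "\<forall>x\<in>B. f x \<in> N x"
      using less.hyps[of B N] finB finN cond tight(1)
      by (metis order_trans psubset_imp_subset subsetD)
    have "card (A - B) < card A"
      using tight fin by (metis Diff_subset Diff_eq_empty_iff double_diff psubsetI psubset_card_mono
          psubset_imp_subset subset_refl Diff_empty)
    moreover have "card X \<le> card (\<Union>(N' ` X))" if X: "X \<subseteq> A - B" for X
    proof -
      have eq: "\<Union>(N ` (X \<union> B)) = \<Union>(N' ` X) \<union> \<Union>(N ` B)"
        by (auto simp: N'_def)
      have finX: "finite X" using X fin by (meson Diff_subset finite_subset)
      have "card X + card B = card (X \<union> B)"
        using X finX finB by (subst card_Un_disjoint) auto
      also have "\<dots> \<le> card (\<Union>(N ` (X \<union> B)))"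
        using cond[of "X \<union> B"] X tight(1) by blast
      also have "\<dots> \<le> card (\<Union>(N' ` X)) + card (\<Union>(N ` B))"
        unfolding eq by (rule card_Un_le)
      finally show ?thesis using tight(3) by simp
    qed
    ultimately obtain g where g: "inj_on g (A - B)" "\<forall>x\<in>A - B. g x \<in> N' x"
      using less.hyps[of "A - B" N'] fin finN by (metis Diff_iff N'_def finite_Diff)
    define h where "h x = (if x \<in> B then f x else g x)" for x
    have "inj_on h A"
      using f g unfolding inj_on_def h_def N'_def
      by (metis (no_types, lifting) DiffD2 DiffI UN_iff)
    moreover have "\<forall>x\<in>A. h x \<in> N x"
      using f g by (auto simp: h_def N'_def)
    ultimately show ?thesis by blast
  next
    case loose
    then obtain x where x: "x \<in> A" by blast
    have "card {x} \<le> card (\<Union>(N ` {x}))" using cond[of "{x}"] x by blast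
    then obtain y where y: "y \<in> N x" by fastforce
    define N' where "N' z = N z - {y}" for z
    have "card (A - {x}) < card A" using fin x by (rule card_Diff1_less)
    moreover have "card X \<le> card (\<Union>(N' ` X))" if X: "X \<subseteq> A - {x}" for X
    proof (cases "X = {}")
      case False
      have "card X < card (\<Union>(N ` X))"
        using loose(2)[of X] False X x by blast
      moreover have "\<Union>(N' ` X) = \<Union>(N ` X) - {y}" by (auto simp: N'_def)
      moreover have "finite (\<Union>(N ` X))" using finU X by blast
      ultimately show ?thesis
        by (cases "y \<in> \<Union>(N ` X)") auto
    qed simp
    ultimately obtain g where g: "inj_on g (A - {x})" "\<forall>z\<in>A - {x}. g z \<in> N' z"
      using less.hyps[of "A - {x}" N'] fin finN by (metis Diff_iff N'_def finite_Diff)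
    have "inj_on (g(x := y)) A"
      using g x unfolding inj_on_def N'_def by auto
    moreover have "\<forall>z\<in>A. (g(x := y)) z \<in> N z"
      using g y by (auto simp: N'_def)
    ultimately show ?thesis by blast
  qed auto
qed

section \<open>Tilings\<close>

lemma reachable_refl: "reachable G x x"
  by (simp add: reachable_def)

lemma reachable_edge: "{x, y} \<in> edges G \<Longrightarrow> reachable G x y"
  by (auto simp: reachable_def)

lemma reachable_trans: "reachable G x y \<Longrightarrow> reachable G y z \<Longrightarrow> reachable G x z"
  by (simp add: reachable_def)

lemma reachable_sym: "reachable G x y \<Longrightarrow> reachable G y x"
proof -
  have "sym {(u, v). {u, v} \<in> edges G}" by (auto simp: sym_def insert_commute)
  then show "reachable G x y \<Longrightarrow> reachable G y x"
    unfolding reachable_def by (meson sym_rtrancl symD)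
qed

lemma connected_graphI:
  assumes "c \<in> verts G" and "\<And>x. x \<in> verts G \<Longrightarrow> reachable G c x"
  shows "connected_graph G"
  using assms unfolding connected_graph_def by (metis empty_iff reachable_sym reachable_trans)

lemma reachable_map:
  assumes "reachable G x y" and "\<And>u v. {u, v} \<in> edges G \<Longrightarrow> reachable H (f u) (f v)"
  shows "reachable H (f x) (f y)"
  using assms(1) unfolding reachable_def
proof (induction rule: rtrancl_induct)
  case (step y z)
  then show ?case using assms(2)[of y z] unfolding reachable_def by simp
qed simp

lemma graph_iso_refl: "graph_iso G G"
  unfolding graph_iso_def by (intro exI[of _ id]) auto

lemma graph_iso_trans:
  assumes "graph_iso G H" and "graph_iso H K"
  shows "graph_iso G K"
proof -
  obtain f where f: "bij_betw f (verts G) (verts H)"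
    "\<forall>x\<in>verts G. \<forall>y\<in>verts G. {x, y} \<in> edges G \<longleftrightarrow> {f x, f y} \<in> edges H"
    using assms(1) unfolding graph_iso_def by blast
  obtain g where g: "bij_betw g (verts H) (verts K)"
    "\<forall>x\<in>verts H. \<forall>y\<in>verts H. {x, y} \<in> edges H \<longleftrightarrow> {g x, g y} \<in> edges K"
    using assms(2) unfolding graph_iso_def by blast
  show ?thesis
    unfolding graph_iso_def
  proof (intro exI[of _ "g \<circ> f"] conjI ballI)
    show "bij_betw (g \<circ> f) (verts G) (verts K)" using f g bij_betw_trans by blast
    fix x y assume xy: "x \<in> verts G" "y \<in> verts G"
    then have "f x \<in> verts H" "f y \<in> verts H" using f(1) by (auto dest: bij_betwE)
    then show "{x, y} \<in> edges G \<longleftrightarrow> {(g \<circ> f) x, (g \<circ> f) y} \<in> edges K"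
      using f(2) g(2) xy by simp
  qed
qed

section \<open>Vertex-disjoint tiles and the factors they form\<close>

definition tiles :: "'b ugraph set \<Rightarrow> 'a set set \<Rightarrow> 'a ugraph set" where
  "tiles \<H> E = {B. connected_graph B \<and> edges B \<subseteq> E \<and> edges B \<subseteq> Pow (verts B) \<and>
     (\<exists>H\<in>\<H>. graph_iso B H)}"

text \<open>Host edges \<open>E\<close> and covered vertices \<open>U\<close> are separate
  parameters, so that tilings of disjoint sets can be united inside one host. Tiles need not be
  induced subgraphs of the host.\<close>

definition tileable :: "'b ugraph set \<Rightarrow> 'a set set \<Rightarrow> 'a set \<Rightarrow> bool" where
  "tileable \<H> E U \<longleftrightarrow> (\<exists>\<B>\<subseteq>tiles \<H> E.
     (\<forall>B\<in>\<B>. \<forall>C\<in>\<B>. B \<noteq> C \<longrightarrow> verts B \<inter> verts C = {}) \<and> \<Union>(verts ` \<B>) = U)"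

lemma tileable_empty: "tileable \<H> E {}"
  unfolding tileable_def by (rule exI[of _ "{}"]) simp

lemma tileable_tile: "B \<in> tiles \<H> E \<Longrightarrow> tileable \<H> E (verts B)"
  unfolding tileable_def by (rule exI[of _ "{B}"]) simp

lemma tileable_Un:
  assumes "tileable \<H> E U" and "tileable \<H> E W" and "U \<inter> W = {}"
  shows "tileable \<H> E (U \<union> W)"
proof -
  obtain \<B> where B: "\<B> \<subseteq> tiles \<H> E"
    "\<forall>B\<in>\<B>. \<forall>C\<in>\<B>. B \<noteq> C \<longrightarrow> verts B \<inter> verts C = {}" "\<Union>(verts ` \<B>) = U"
    using assms(1) unfolding tileable_def by blast
  obtain \<C> where C: "\<C> \<subseteq> tiles \<H> E"
    "\<forall>B\<in>\<C>. \<forall>C\<in>\<C>. B \<noteq> C \<longrightarrow> verts B \<inter> verts C = {}" "\<Union>(verts ` \<C>) = W"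
    using assms(2) unfolding tileable_def by blast
  have "verts B \<inter> verts C = {}" if "B \<in> \<B>" "C \<in> \<C>" for B C
    using that B(3) C(3) assms(3) by blast
  then show ?thesis
    unfolding tileable_def
  proof (intro exI[of _ "\<B> \<union> \<C>"] conjI ballI impI)
    fix B C assume BC: "B \<in> \<B> \<union> \<C>" "C \<in> \<B> \<union> \<C>" "B \<noteq> C"
    then consider "B \<in> \<B>" "C \<in> \<B>" | "B \<in> \<C>" "C \<in> \<C>" | "B \<in> \<B>" "C \<in> \<C>" | "C \<in> \<B>" "B \<in> \<C>"
      by blast
    then show "verts B \<inter> verts C = {}"
      using B(2) C(2) BC(3) \<open>\<And>C B. B \<in> \<B> \<Longrightarrow> C \<in> \<C> \<Longrightarrow> verts B \<inter> verts C = {}\<close> by cases blast+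
  qed (use B C in auto)
qed

text \<open>Let \<open>F\<close> be the union of the tiles. As tiles are vertex-disjoint, no edge of
  \<open>F\<close> leaves a tile, and each tile is connected; hence the components of
  \<open>F\<close> are exactly the tiles.\<close>

lemma factor_if_tileable:
  assumes "simple_graph G" and "tileable \<H> (edges G) (verts G)"
  shows "\<exists>F. is_factor \<H> G F"
proof -
  obtain \<B> where B: "\<B> \<subseteq> tiles \<H> (edges G)"
    "\<forall>B\<in>\<B>. \<forall>C\<in>\<B>. B \<noteq> C \<longrightarrow> verts B \<inter> verts C = {}" "\<Union>(verts ` \<B>) = verts G"
    using assms(2) unfolding tileable_def by blast
  define F where "F = \<lparr>verts = verts G, edges = \<Union>(edges ` \<B>)\<rparr>"
  have tile: "connected_graph B" "edges B \<subseteq> edges G" "edges B \<subseteq> Pow (verts B)"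
    "\<exists>H\<in>\<H>. graph_iso B H" if "B \<in> \<B>" for B
    using that B(1) by (auto simp: tiles_def)
  have card2: "card e = 2" if "e \<in> edges G" for e
    using that assms(1) by (simp add: simple_graph_def)
  have "\<exists>H\<in>\<H>. graph_iso C H" if C: "C \<in> components F" for C
  proof -
    obtain x where x: "x \<in> verts G" "C = induced F {y \<in> verts F. reachable F x y}"
      using C by (auto simp: components_def F_def)
    obtain B where xB: "B \<in> \<B>" "x \<in> verts B" using x(1) B(3) by blast
    have own: "e \<in> edges B" if e: "e \<in> edges F" "e \<inter> verts B \<noteq> {}" for e
    proof -
      obtain D where D: "D \<in> \<B>" "e \<in> edges D" using e(1) by (auto simp: F_def)
      have "verts D \<inter> verts B \<noteq> {}" using e(2) tile(3)[OF D(1)] D(2) by fastforce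
      then have "D = B" using B(2) D(1) xB(1) by metis
      then show ?thesis using D(2) by simp
    qed
    have "y \<in> verts B" if "reachable F x y" for y
      using that unfolding reachable_def
    proof (induction rule: rtrancl_induct)
      case (step y z)
      then have "{y, z} \<in> edges B" using own[of "{y, z}"] by simp
      then show ?case using tile(3)[OF xB(1)] by blast
    qed (rule xB(2))
    moreover have "reachable F x y" if "y \<in> verts B" for y
    proof -
      have "reachable B x y"
        using tile(1)[OF xB(1)] xB(2) that by (simp add: connected_graph_def)
      moreover have "reachable F (id u) (id v)" if "{u, v} \<in> edges B" for u v
        using that xB(1) by (auto simp: F_def intro!: reachable_edge)
      ultimately show ?thesis
        using reachable_map[of B x y F id] by simp
    qed
    ultimately have "{y \<in> verts F. reachable F x y} = verts B"
      using B(3) xB(1) by (auto simp: F_def)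
    moreover have "{e \<in> edges F. e \<subseteq> verts B} = edges B"
    proof
      show "{e \<in> edges F. e \<subseteq> verts B} \<subseteq> edges B"
      proof
        fix e assume e: "e \<in> {e \<in> edges F. e \<subseteq> verts B}"
        \<comment> \<open>An empty edge would be contained in \<open>verts B\<close> without meeting
          it; edges of \<open>G\<close> have two elements.\<close>
        then have "card e = 2" using tile(2) card2 by (fastforce simp: F_def)
        then have "e \<inter> verts B \<noteq> {}" using e by (cases "e = {}") auto
        then show "e \<in> edges B" using e own by blast
      qed
      show "edges B \<subseteq> {e \<in> edges F. e \<subseteq> verts B}"
        using tile(3)[OF xB(1)] xB(1) by (auto simp: F_def)
    qed
    ultimately have "C = B" using x(2) by (simp add: induced_def)
    then show ?thesis using tile(4) xB(1) by blast
  qed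
  moreover have "spanning_subgraph F G"
    using tile(2) by (auto simp: spanning_subgraph_def F_def)
  ultimately show ?thesis unfolding is_factor_def by blast
qed

definition map_graph :: "('a \<Rightarrow> 'b) \<Rightarrow> 'a ugraph \<Rightarrow> 'b ugraph" where
  "map_graph f G = \<lparr>verts = f ` verts G, edges = (`) f ` edges G\<rparr>"

lemma tile_map_graph:
  assumes B: "B \<in> tiles \<H> E" and inj: "inj_on f (verts B)"
  shows "map_graph f B \<in> tiles \<H> ((`) f ` E)"
proof -
  have tile: "connected_graph B" "edges B \<subseteq> E" "edges B \<subseteq> Pow (verts B)"
    using B by (auto simp: tiles_def)
  obtain H where H: "H \<in> \<H>" "graph_iso B H" using B by (auto simp: tiles_def)
  have "reachable (map_graph f B) (f x) (f y)" if "x \<in> verts B" "y \<in> verts B" for x y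
  proof (rule reachable_map[where f = f and G = B])
    show "reachable B x y" using tile(1) that by (simp add: connected_graph_def)
    show "reachable (map_graph f B) (f u) (f v)" if "{u, v} \<in> edges B" for u v
      using imageI[OF that, of "image f"] by (intro reachable_edge) (simp add: map_graph_def)
  qed
  then have "connected_graph (map_graph f B)"
    using tile(1) by (auto simp: connected_graph_def map_graph_def)
  moreover have "graph_iso (map_graph f B) B"
    unfolding graph_iso_def
  proof (intro exI[of _ "inv_into (verts B) f"] conjI ballI)
    show "bij_betw (inv_into (verts B) f) (verts (map_graph f B)) (verts B)"
      using inj by (simp add: map_graph_def bij_betw_inv_into inj_on_imp_bij_betw)
    fix x' y' assume "x' \<in> verts (map_graph f B)" "y' \<in> verts (map_graph f B)"
    then obtain x y where xy: "x' = f x" "y' = f y" "x \<in> verts B" "y \<in> verts B"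
      by (auto simp: map_graph_def)
    have "{x', y'} \<in> edges (map_graph f B) \<longleftrightarrow> f ` {x, y} \<in> (`) f ` edges B"
      using xy by (simp add: map_graph_def)
    also have "\<dots> \<longleftrightarrow> {x, y} \<in> edges B"
    proof (rule inj_on_image_mem_iff)
      show "inj_on ((`) f) (Pow (verts B))" using inj by (rule inj_on_image_Pow)
      show "{x, y} \<in> Pow (verts B)" using xy by simp
      show "edges B \<subseteq> Pow (verts B)" by (rule tile(3))
    qed
    finally show "{x', y'} \<in> edges (map_graph f B) \<longleftrightarrow>
        {inv_into (verts B) f x', inv_into (verts B) f y'} \<in> edges B"
      using xy inj by simp
  qed
  ultimately show ?thesis
    using tile H graph_iso_trans unfolding tiles_def map_graph_def by fastforce
qed

text \<open>Used to carry a tiling built on natural-number vertices back to an arbitrary vertex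
  type.\<close>

lemma tileable_image:
  assumes "tileable \<H> E U" and inj: "inj_on f U"
  shows "tileable \<H> ((`) f ` E) (f ` U)"
proof -
  obtain \<B> where B: "\<B> \<subseteq> tiles \<H> E"
    "\<forall>B\<in>\<B>. \<forall>C\<in>\<B>. B \<noteq> C \<longrightarrow> verts B \<inter> verts C = {}" "\<Union>(verts ` \<B>) = U"
    using assms(1) unfolding tileable_def by blast
  have sub: "verts B \<subseteq> U" if "B \<in> \<B>" for B using that B(3) by blast
  show ?thesis
    unfolding tileable_def
  proof (intro exI[of _ "map_graph f ` \<B>"] conjI ballI impI)
    show "map_graph f ` \<B> \<subseteq> tiles \<H> ((`) f ` E)"
    proof (rule image_subsetI)
      fix B assume "B \<in> \<B>"
      then show "map_graph f B \<in> tiles \<H> ((`) f ` E)"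
        using B(1) inj_on_subset[OF inj sub] by (intro tile_map_graph) auto
    qed
    show "\<Union> (verts ` map_graph f ` \<B>) = f ` U"
      using B(3) by (auto simp: map_graph_def)
    fix C D assume "C \<in> map_graph f ` \<B>" "D \<in> map_graph f ` \<B>" "C \<noteq> D"
    then obtain C' D' where CD: "C = map_graph f C'" "D = map_graph f D'" "C' \<in> \<B>" "D' \<in> \<B>"
      "C' \<noteq> D'" by blast
    then have "verts C' \<inter> verts D' = {}" using B(2) by blast
    then show "verts C \<inter> verts D = {}"
      using CD sub inj inj_on_image_Int[OF inj, of "verts C'" "verts D'"] by (simp add: map_graph_def)
  qed
qed

section \<open>Stars\<close>

definition star_on :: "'a \<Rightarrow> 'a set \<Rightarrow> 'a ugraph" where
  "star_on c L = \<lparr>verts = insert c L, edges = (\<lambda>l. {c, l}) ` L\<rparr>"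

lemma connected_star_on: "connected_graph (star_on c L)"
  by (rule connected_graphI[of c]) (auto simp: star_on_def reachable_refl intro: reachable_edge)

lemma star_on_iso:
  assumes "finite L" and "c \<notin> L"
  shows "graph_iso (star_on c L) (star (card L))"
proof -
  have "card L = card {1..card L}" by simp
  then obtain g where g: "bij_betw g L {1..card L}"
    using finite_same_card_bij[OF assms(1)] by blast
  define f where "f = g(c := 0)"
  have fg: "f x = g x" if "x \<in> L" for x using that assms(2) by (auto simp: f_def)
  have fc: "f c = 0" by (simp add: f_def)
  have gpos: "g x \<in> {1..card L}" if "x \<in> L" for x using that g by (auto dest: bij_betwE)
  have "bij_betw f (insert c L) (insert 0 {1..card L})"
    using notIn_Un_bij_betw[of c L f "{1..card L}"] g fg fc assms(2) bij_betw_cong[of L f g]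
    by simp
  moreover have "insert 0 {1..card L} = {0..card L}" by auto
  ultimately have bij: "bij_betw f (verts (star_on c L)) (verts (star (card L)))"
    by (simp add: star_on_def star_def)
  have e1: "{x, y} \<in> edges (star_on c L) \<longleftrightarrow> (x = c \<and> y \<in> L) \<or> (y = c \<and> x \<in> L)" for x y
    by (auto simp: star_on_def doubleton_eq_iff)
  have e2: "{i, j} \<in> edges (star (card L)) \<longleftrightarrow>
      (i = 0 \<and> j \<in> {1..card L}) \<or> (j = 0 \<and> i \<in> {1..card L})" for i j
    by (auto simp: star_def doubleton_eq_iff)
  show ?thesis
    unfolding graph_iso_def
  proof (intro exI[of _ f] conjI ballI bij)
    fix x y assume "x \<in> verts (star_on c L)" "y \<in> verts (star_on c L)"
    then have "x = c \<or> x \<in> L" "y = c \<or> y \<in> L" by (auto simp: star_on_def)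
    then show "{x, y} \<in> edges (star_on c L) \<longleftrightarrow> {f x, f y} \<in> edges (star (card L))"
      unfolding e1 e2 using assms(2) fg fc gpos by fastforce
  qed
qed

lemma star_on_tile:
  assumes "finite L" and "c \<notin> L" and "card L \<in> {1..k}" and "star ` {1..k} \<subseteq> \<H>"
    and "\<And>l. l \<in> L \<Longrightarrow> {c, l} \<in> E"
  shows "star_on c L \<in> tiles \<H> E"
proof -
  have "star (card L) \<in> \<H>" using assms(3,4) by blast
  then show ?thesis
    using connected_star_on[of c L] star_on_iso[OF assms(1,2)] assms(5)
    by (auto simp: tiles_def star_on_def)
qed

text \<open>Cut off the first two vertices as a \<open>K_{1,1}\<close> while at least two others
  remain. A path on three vertices is a \<open>K_{1,2}\<close> centred at its middle vertex, which
  is available since \<open>2 \<le> k\<close>.\<close>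

lemma tileable_path:
  assumes "star ` {1..k} \<subseteq> \<H>" and "2 \<le> k"
    and "distinct p" and "2 \<le> length p" and "successively (\<lambda>x y. {x, y} \<in> E) p"
  shows "tileable \<H> E (set p)"
  using assms(3-)
proof (induction "length p" arbitrary: p rule: less_induct)
  case less
  obtain x y q where p: "p = x # y # q"
    using less.prems(2) by (metis One_nat_def Suc_1 Suc_le_length_iff)
  have edge: "tileable \<H> E {x, y}"
    using tileable_tile[OF star_on_tile[of "{y}" x k \<H> E]] assms(1,2) less.prems p
    by (simp add: star_on_def)
  consider "q = []" | z where "q = [z]" | "2 \<le> length q"
    by (metis One_nat_def Suc_1 length_0_conv length_Suc_conv less_2_cases_iff not_le)
  then show ?case
  proof cases
    case 1
    then show ?thesis using edge p by simp
  next
    case 2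
    have "star_on y {x, z} \<in> tiles \<H> E"
      using assms(1,2) less.prems p 2
      by (intro star_on_tile[where k = k]) (auto simp: insert_commute)
    then show ?thesis
      using tileable_tile[of "star_on y {x, z}" \<H> E] p 2 by (simp add: star_on_def insert_commute)
  next
    case 3
    have "successively (\<lambda>x y. {x, y} \<in> E) q"
      using less.prems(3) p by (auto simp: successively_Cons)
    then have "tileable \<H> E (set q)"
      using less.hyps[of q] less.prems 3 p by simp
    then show ?thesis
      using tileable_Un[OF edge, of "set q"] less.prems(1) p by auto
  qed
qed

section \<open>From permutations along edges to stars\<close>

lemma cycle_decomp_permutes: "cycle_decomp I p \<Longrightarrow> p permutes I"
proof (induction rule: cycle_decomp.induct)
  case (comp I p cs)
  show ?case
    using permutes_compose[OF permutes_subset[OF comp.IH] permutes_subset[OF cycle_permutes],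
        of "set cs \<union> I" cs] by (simp add: comp_def)
qed (simp add: permutes_def)

text \<open>Each cycle of \<open>\<sigma>\<close> has length at least two and, once its closing edge
  is dropped, is a path. A cycle of length two is a single edge.\<close>

lemma tileable_permutation:
  assumes "star ` {1..k} \<subseteq> \<H>" and "2 \<le> k"
    and "finite W" and "\<sigma> permutes W" and "\<And>x. x \<in> W \<Longrightarrow> {x, \<sigma> x} \<in> E \<and> \<sigma> x \<noteq> x"
  shows "tileable \<H> E W"
proof -
  have "cycle_decomp W \<sigma>" using assms(3,4) by (rule cycle_decomposition[rotated])
  then show ?thesis
    using assms(5)
  proof (induction rule: cycle_decomp.induct)
    case empty
    then show ?case by (simp add: tileable_empty)
  next
    case (comp I p cs)
    have perm: "p permutes I"
      using comp.hyps(1) by (rule cycle_decomp_permutes)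
    have onI: "(cycle_of_list cs \<circ> p) x = p x" if "x \<in> I" for x
    proof -
      have "p x \<in> I" using perm that by (simp add: permutes_in_image)
      then show ?thesis using comp.hyps(3) by (auto intro: id_outside_supp)
    qed
    then have I: "tileable \<H> E I" using comp.IH comp.prems by (metis UnCI)
    have oncs: "(cycle_of_list cs \<circ> p) x = cycle_of_list cs x" if "x \<in> set cs" for x
      using that comp.hyps(3) perm by (auto simp: permutes_def)
    \<comment> \<open>The cycle sends each entry of \<open>cs\<close> to its cyclic successor, so
      \<open>rotate1 cs\<close> lists the images in order.\<close>
    have rot: "map (cycle_of_list cs) cs = rotate1 cs"
      using cyclic_rotation[OF comp.hyps(2), of 1] by simp
    have step: "{cs ! i, rotate1 cs ! i} \<in> E \<and> rotate1 cs ! i \<noteq> cs ! i" if "i < length cs" for i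
      using comp.prems[of "cs ! i"] oncs[of "cs ! i"] that rot
      by (metis UnI1 nth_map nth_mem)
    have "tileable \<H> E (set cs)"
    proof (cases "cs = []")
      case False
      \<comment> \<open>A cycle with one entry would be a fixed point.\<close>
      have len: "2 \<le> length cs"
      proof (rule ccontr)
        assume "\<not> 2 \<le> length cs"
        with False obtain c where "cs = [c]"
          by (metis One_nat_def Suc_1 length_0_conv length_Suc_conv less_2_cases_iff not_le)
        then show False using step[of 0] by simp
      qed
      have "successively (\<lambda>x y. {x, y} \<in> E) cs"
        unfolding successively_conv_nth
      proof (intro allI impI)
        fix i assume "Suc i < length cs"
        then show "{cs ! i, cs ! Suc i} \<in> E" using step[of i] by (simp add: nth_rotate1)
      qed
      then show ?thesis using tileable_path assms(1,2) comp.hyps(2) len by blast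
    qed (simp add: tileable_empty)
    then show ?case using I comp.hyps(3) by (intro tileable_Un)
  qed
qed

section \<open>Assigning two ends to each vertex of an independent set\<close>

text \<open>
  An assignment of a pair \<open>a i\<close>, \<open>b i\<close> to each \<open>i \<in> J\<close> is a multigraph with edge set \<open>J\<close>, and
  \<open>load\<close> is its degree function, in which a loop counts twice.
\<close>

definition load :: "'i set \<Rightarrow> ('i \<Rightarrow> 's) \<Rightarrow> ('i \<Rightarrow> 's) \<Rightarrow> 's \<Rightarrow> nat" where
  "load J a b s = (\<Sum>i\<in>J. of_bool (a i = s) + of_bool (b i = s))"

lemma load_empty [simp]: "load {} a b s = 0"
  by (simp add: load_def)

lemma load_insert [simp]:
  "finite J \<Longrightarrow> i \<notin> J \<Longrightarrow>
    load (insert i J) a b s = of_bool (a i = s) + of_bool (b i = s) + load J a b s"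
  by (simp add: load_def)

lemma load_split: "finite J \<Longrightarrow> X \<subseteq> J \<Longrightarrow> load J a b s = load (J - X) a b s + load X a b s"
  unfolding load_def by (rule sum.subset_diff)

lemma load_cong:
  assumes "\<And>i. i \<in> J \<Longrightarrow> a i = a' i \<and> b i = b' i"
  shows "load J a b s = load J a' b' s"
  unfolding load_def by (rule sum.cong) (use assms in auto)

lemma load_pos: "finite J \<Longrightarrow> i \<in> J \<Longrightarrow> s \<in> {a i, b i} \<Longrightarrow> 1 \<le> load J a b s"
  unfolding load_def
  by (rule order_trans[OF _ member_le_sum[of i]]) auto

lemma load_zero: "(\<And>i. i \<in> J \<Longrightarrow> s \<notin> {a i, b i}) \<Longrightarrow> load J a b s = 0"
  unfolding load_def by (rule sum.neutral) auto

lemma load_nonloops: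
  assumes "finite J" and "\<And>i. i \<in> J \<Longrightarrow> a i \<noteq> b i"
  shows "load J a b s = card {i \<in> J. s \<in> {a i, b i}}"
proof -
  have "load J a b s = (\<Sum>i\<in>J. of_bool (s \<in> {a i, b i}))"
    unfolding load_def by (rule sum.cong) (use assms(2) in auto)
  also have "\<dots> = card {i \<in> J. s \<in> {a i, b i}}"
    using assms(1) by (simp add: of_bool_def sum.If_cases Int_def)
  finally show ?thesis .
qed

lemma load_loops:
  assumes "finite J" and "\<And>i. i \<in> J \<Longrightarrow> a i = b i"
  shows "load J a b s = 2 * card {i \<in> J. a i = s}"
proof -
  have "load J a b s = (\<Sum>i\<in>J. 2 * of_bool (a i = s))"
    unfolding load_def by (rule sum.cong) (use assms(2) in auto)
  also have "\<dots> = 2 * card {i \<in> J. a i = s}"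
    using assms(1) by (simp add: of_bool_def sum.If_cases Int_def flip: sum_distrib_left)
  finally show ?thesis .
qed

text \<open>The source of all parity arguments: load \<open>2k + 1\<close> forces an odd number of
  non-loops, and load \<open>2\<close> with a non-loop present forces exactly two of them.\<close>

lemma load_eq:
  assumes "finite J"
  shows "load J a b s =
    card {i \<in> J. a i \<noteq> b i \<and> s \<in> {a i, b i}} + 2 * card {i \<in> J. a i = b i \<and> a i = s}"
proof -
  let ?L = "{i \<in> J. a i \<noteq> b i}"
  have "load J a b s = load (J - ?L) a b s + load ?L a b s"
    using assms by (intro load_split) auto
  moreover have "load (J - ?L) a b s = 2 * card {i \<in> J - ?L. a i = s}"
    by (rule load_loops) (use assms in auto)
  moreover have "load ?L a b s = card {i \<in> ?L. s \<in> {a i, b i}}"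
    by (rule load_nonloops) (use assms in auto)
  moreover have "{i \<in> J - ?L. a i = s} = {i \<in> J. a i = b i \<and> a i = s}"
    "{i \<in> ?L. s \<in> {a i, b i}} = {i \<in> J. a i \<noteq> b i \<and> s \<in> {a i, b i}}" by auto
  ultimately show ?thesis by simp
qed

text \<open>
  Each \<open>i\<close> looks for two of the \<open>2k + 1\<close> slots of its neighbours. Dummies that may only use the
  slots \<open>2, \<dots>, 2k\<close> make the matching perfect, so that the slots \<open>0\<close> and \<open>1\<close> go to elements of \<open>I\<close>.
\<close>

lemma assignment_exists:
  fixes I :: "'i set" and S :: "'s set"
  assumes finI: "finite I" and finS: "finite S" and NS: "\<And>i. i \<in> I \<Longrightarrow> N i \<subseteq> S"
    and "1 \<le> k"
    and upper: "\<And>X. X \<subseteq> I \<Longrightarrow> 2 * card X \<le> (2 * k + 1) * card (\<Union>(N ` X))"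
    and lower: "\<And>X. X \<subseteq> I \<Longrightarrow> card X + card S \<le> card I + card (\<Union>(N ` X))"
  shows "\<exists>a b. (\<forall>i\<in>I. a i \<in> N i \<and> b i \<in> N i) \<and>
    (\<forall>s\<in>S. 2 \<le> load I a b s \<and> load I a b s \<le> 2 * k + 1)"
proof -
  \<comment> \<open>The number of dummies: the slots left over after each element of
    \<open>I\<close> has received two.\<close>
  define d where "d = (2 * k + 1) * card S - 2 * card I"
  have "card (\<Union>(N ` I)) \<le> card S" using NS finS by (intro card_mono) auto
  then have "(2 * k + 1) * card (\<Union>(N ` I)) \<le> (2 * k + 1) * card S" by (rule mult_le_mono2)
  then have d: "2 * card I + d = (2 * k + 1) * card S"
    using upper[of I] by (simp add: d_def)
  define A :: "('i \<times> nat + nat) set" where "A = (I \<times> {..<2}) <+> {..<d}"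
  define M :: "'i \<times> nat + nat \<Rightarrow> ('s \<times> nat) set" where
    "M = case_sum (\<lambda>(i, c). N i \<times> {..<2 * k + 1}) (\<lambda>_. S \<times> {2..<2 * k + 1})"
  have finA: "finite A" using finI by (simp add: A_def)
  have cardA: "card A = (2 * k + 1) * card S"
    using finI d by (simp add: A_def card_Plus card_cartesian_product)
  have finN: "finite (N i)" if "i \<in> I" for i using NS[OF that] finS finite_subset by blast
  have MS: "M x \<subseteq> S \<times> {..<2 * k + 1}" if "x \<in> A" for x
    using that NS by (fastforce simp: A_def M_def)
  have "\<exists>f. inj_on f A \<and> (\<forall>x\<in>A. f x \<in> M x)"
  proof (rule hall)
    show "finite (M x)" if "x \<in> A" for x
      using MS[OF that] finS by (meson finite_SigmaI finite_lessThan finite_subset)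
    fix X assume X: "X \<subseteq> A"
    define Y where "Y = {i \<in> I. \<exists>c. Inl (i, c) \<in> X}"
    define Q where "Q = \<Union>(N ` Y)"
    have Y: "Y \<subseteq> I" by (auto simp: Y_def)
    have XY: "x \<in> (Y \<times> {..<2}) <+> {..<d}" if "x \<in> X" for x
    proof (cases x)
      case (Inl y)
      obtain i c where "y = (i, c)" by (cases y)
      with Inl that have "Inl (i, c) \<in> X" by simp
      moreover from this X have "i \<in> I" "c < 2" by (auto simp: A_def)
      ultimately show ?thesis using Inl \<open>y = (i, c)\<close> by (auto simp: Y_def)
    next
      case (Inr j)
      then show ?thesis using X that by (auto simp: A_def)
    qed
    have QS: "Q \<subseteq> S" using NS Y by (auto simp: Q_def)
    have finY: "finite Y" and finQ: "finite Q"
      using Y QS finI finS finite_subset by blast+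
    have QM: "Q \<times> {..<2 * k + 1} \<subseteq> \<Union>(M ` X)"
    proof
      fix y assume "y \<in> Q \<times> {..<2 * k + 1}"
      then obtain i c where "Inl (i, c) \<in> X" "y \<in> N i \<times> {..<2 * k + 1}"
        by (auto simp: Q_def Y_def)
      then show "y \<in> \<Union>(M ` X)" by (intro UN_I[of "Inl (i, c)"]) (auto simp: M_def)
    qed
    have fin: "finite (\<Union>(M ` X))"
    proof (rule finite_subset)
      show "\<Union>(M ` X) \<subseteq> S \<times> {..<2 * k + 1}"
        using MS X by (meson UN_least subsetD)
      show "finite (S \<times> {..<2 * k + 1})" using finS by simp
    qed
    show "card X \<le> card (\<Union>(M ` X))"
    \<comment> \<open>Without dummies only the slots of \<open>Q\<close> are available, and
      \<open>upper\<close> suffices. With a dummy all slots from \<open>2\<close> on are available,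
      plus the slots \<open>0\<close> and \<open>1\<close> of \<open>Q\<close>; twice
      \<open>lower\<close> gives the count.\<close>
    proof (cases "\<exists>j. Inr j \<in> X")
      case False
      have "X \<subseteq> Inl ` (Y \<times> {..<2})"
      proof
        fix x assume "x \<in> X"
        then show "x \<in> Inl ` (Y \<times> {..<2})" using XY[of x] False by (auto elim!: PlusE)
      qed
      then have "card X \<le> card (Inl ` (Y \<times> {..<2}) :: ('i \<times> nat + nat) set)"
        using finY by (intro card_mono) auto
      also have "\<dots> = 2 * card Y" by (simp add: card_image card_cartesian_product)
      also have "\<dots> \<le> (2 * k + 1) * card Q" using upper[OF Y] by (simp add: Q_def)
      also have "\<dots> = card (Q \<times> {..<2 * k + 1})" by (simp add: card_cartesian_product)
      also have "\<dots> \<le> card (\<Union>(M ` X))" using fin QM by (rule card_mono)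
      finally show ?thesis .
    next
      case True
      have "X \<subseteq> (Y \<times> {..<2}) <+> {..<d}"
        using XY by blast
      then have "card X \<le> card ((Y \<times> {..<2 :: nat}) <+> {..<d})"
        using finY by (intro card_mono) auto
      also have "\<dots> = 2 * card Y + d"
        using finY by (simp add: card_Plus card_cartesian_product)
      also have "\<dots> \<le> 2 * card Q + (2 * k - 1) * card S"
      proof -
        have "(2 * k + 1) * card S = (2 * k - 1) * card S + 2 * card S"
          using \<open>1 \<le> k\<close> by (simp add: diff_mult_distrib)
        then show ?thesis using lower[OF Y] d by (simp add: Q_def)
      qed
      also have "\<dots> = card (Q \<times> {..<2} \<union> S \<times> {2..<2 * k + 1})"
        using finQ finS by (subst card_Un_disjoint) (auto simp: card_cartesian_product)
      also have "\<dots> \<le> card (\<Union>(M ` X))"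
      proof (rule card_mono[OF fin])
        have "S \<times> {2..<2 * k + 1} \<subseteq> \<Union>(M ` X)" using True by (force simp: M_def)
        moreover have "Q \<times> {..<2} \<subseteq> Q \<times> {..<2 * k + 1}" using \<open>1 \<le> k\<close> by auto
        ultimately show "Q \<times> {..<2} \<union> S \<times> {2..<2 * k + 1} \<subseteq> \<Union>(M ` X)" using QM by blast
      qed
      finally show ?thesis .
    qed
  qed (rule finA)
  then obtain f where f: "inj_on f A" "\<And>x. x \<in> A \<Longrightarrow> f x \<in> M x" by blast
  \<comment> \<open>Both sides have the same size by the choice of \<open>d\<close>, so every slot
    is filled.\<close>
  have onto: "f ` A = S \<times> {..<2 * k + 1}"
  proof (rule card_subset_eq)
    show "finite (S \<times> {..<2 * k + 1})" using finS by simp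
    show "f ` A \<subseteq> S \<times> {..<2 * k + 1}" using f(2) MS by blast
    show "card (f ` A) = card (S \<times> {..<2 * k + 1})"
      using cardA f(1) by (simp add: card_image card_cartesian_product)
  qed
  define u where "u i c = fst (f (Inl (i, c)))" for i and c :: nat
  have inA: "Inl (i, c) \<in> A" if "i \<in> I" "c < 2" for i c using that by (auto simp: A_def)
  have uN: "u i c \<in> N i" if "i \<in> I" "c < 2" for i c
    using f(2)[OF inA[OF that]] by (auto simp: u_def M_def)
  have "2 \<le> load I (\<lambda>i. u i 0) (\<lambda>i. u i 1) s \<and> load I (\<lambda>i. u i 0) (\<lambda>i. u i 1) s \<le> 2 * k + 1"
    if s: "s \<in> S" for s
  proof -
    define T where "T = {x \<in> I \<times> {..<2}. fst (f (Inl x)) = s}"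
    have finT: "finite T" using finI by (simp add: T_def)
    have two: "{..<2} = {0, 1 :: nat}" by auto
    have "load I (\<lambda>i. u i 0) (\<lambda>i. u i 1) s = (\<Sum>i\<in>I. \<Sum>c<2. of_bool (u i c = s))"
      by (simp add: load_def two del: sum_of_bool_eq)
    also have "\<dots> = (\<Sum>x\<in>I \<times> {..<2}. of_bool (fst (f (Inl x)) = s))"
      by (simp add: sum.cartesian_product u_def case_prod_beta del: sum_of_bool_eq)
    also have "\<dots> = card T"
      using finI by (simp add: of_bool_def sum.If_cases Int_def T_def)
    finally have load: "load I (\<lambda>i. u i 0) (\<lambda>i. u i 1) s = card T" .
    have sub: "(f \<circ> Inl) ` T \<subseteq> {s} \<times> {..<2 * k + 1}"
    proof
      fix y assume "y \<in> (f \<circ> Inl) ` T"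
      then obtain x where x: "x \<in> I \<times> {..<2}" "fst (f (Inl x)) = s" "y = f (Inl x)"
        by (auto simp: T_def)
      then have "y \<in> f ` A" by (auto simp: A_def)
      then show "y \<in> {s} \<times> {..<2 * k + 1}" using x onto by (cases y) auto
    qed
    have "inj_on (f \<circ> Inl) T"
      using f(1) by (auto simp: inj_on_def T_def A_def)
    then have "card T = card ((f \<circ> Inl) ` T)" by (rule card_image[symmetric])
    also have "\<dots> \<le> card ({s} \<times> {..<2 * k + 1})" by (intro card_mono sub) simp
    finally have upper': "card T \<le> 2 * k + 1" by (simp add: card_cartesian_product)
    have "{(s, 0), (s, 1)} \<subseteq> (f \<circ> Inl) ` T"
    proof
      fix y assume y: "y \<in> {(s, 0 :: nat), (s, 1)}"
      then have "y \<in> f ` A" using onto s \<open>1 \<le> k\<close> by auto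
      then obtain x where x: "x \<in> A" "y = f x" by blast
      then show "y \<in> (f \<circ> Inl) ` T"
      proof (cases x)
        case (Inl z)
        then show ?thesis using x y by (force simp: T_def A_def)
      next
        case (Inr j)
        then have "y \<in> S \<times> {2..<2 * k + 1}" using f(2)[OF x(1)] x(2) by (simp add: M_def)
        then show ?thesis using y by auto
      qed
    qed
    then have "card {(s, 0 :: nat), (s, 1)} \<le> card T"
      using finT by (meson card_image_le card_mono finite_imageI order_trans)
    then show ?thesis using load upper' by simp
  qed
  then show ?thesis using uN by (intro exI[of _ "\<lambda>i. u i 0"] exI[of _ "\<lambda>i. u i 1"]) auto
qed

section \<open>Exchanges in a minimal assignment\<close>

text \<open>
  Making a set \<open>X\<close> of non-loops \<open>i\<close> into loops at one of their ends \<open>g i\<close> is a reassignment. An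
  assignment with the fewest non-loops admits none that keeps all loads within the bounds.
\<close>

lemma minimal_assignment:
  fixes I :: "'i set" and S :: "'s set"
  assumes finI: "finite I"
    and ex: "\<exists>a b. (\<forall>i\<in>I. a i \<in> N i \<and> b i \<in> N i) \<and> (\<forall>s\<in>S. l \<le> load I a b s \<and> load I a b s \<le> u)"
  obtains a b where "\<And>i. i \<in> I \<Longrightarrow> a i \<in> N i \<and> b i \<in> N i"
    and "\<And>s. s \<in> S \<Longrightarrow> l \<le> load I a b s \<and> load I a b s \<le> u"
    and "\<And>X g. X \<subseteq> I \<Longrightarrow> X \<noteq> {} \<Longrightarrow> (\<And>i. i \<in> X \<Longrightarrow> a i \<noteq> b i \<and> g i \<in> {a i, b i}) \<Longrightarrow>
      \<exists>s\<in>S. \<not> (l \<le> load (I - X) a b s + load X g g s \<and> load (I - X) a b s + load X g g s \<le> u)"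
proof -
  define ok where "ok = (\<lambda>(a, b). (\<forall>i\<in>I. a i \<in> N i \<and> b i \<in> N i) \<and>
    (\<forall>s\<in>S. l \<le> load I a b s \<and> load I a b s \<le> u))"
  define \<mu> where "\<mu> = (\<lambda>(a :: 'i \<Rightarrow> 's, b). card {i \<in> I. a i \<noteq> b i})"
  obtain ab0 where "ok ab0" using ex by (auto simp: ok_def)
  then obtain ab where ab: "ok ab" "\<And>y. ok y \<Longrightarrow> \<mu> ab \<le> \<mu> y"
    using ex_has_least_nat[of ok ab0 \<mu>] by blast
  obtain a b where [simp]: "ab = (a, b)" by (cases ab)
  have "\<exists>s\<in>S. \<not> (l \<le> load (I - X) a b s + load X g g s \<and> load (I - X) a b s + load X g g s \<le> u)"
    if X: "X \<subseteq> I" "X \<noteq> {}" "\<And>i. i \<in> X \<Longrightarrow> a i \<noteq> b i \<and> g i \<in> {a i, b i}" for X g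
  proof (rule ccontr)
    assume neg: "\<not> ?thesis"
    define a' where "a' i = (if i \<in> X then g i else a i)" for i
    define b' where "b' i = (if i \<in> X then g i else b i)" for i
    have "load I a' b' s = load (I - X) a b s + load X g g s" for s
    proof -
      have "load I a' b' s = load (I - X) a' b' s + load X a' b' s"
        using finI X(1) by (rule load_split)
      also have "load (I - X) a' b' s = load (I - X) a b s"
        by (rule load_cong) (simp add: a'_def b'_def)
      also have "load X a' b' s = load X g g s"
        by (rule load_cong) (simp add: a'_def b'_def)
      finally show ?thesis .
    qed
    moreover have "\<forall>i\<in>I. a' i \<in> N i \<and> b' i \<in> N i"
      using ab(1) X by (fastforce simp: a'_def b'_def ok_def)
    ultimately have "ok (a', b')" using neg by (auto simp: ok_def)
    then have "\<mu> (a, b) \<le> \<mu> (a', b')" using ab(2) by simp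
    moreover have "{i \<in> I. a' i \<noteq> b' i} \<subset> {i \<in> I. a i \<noteq> b i}"
      using X by (auto simp: a'_def b'_def)
    then have "\<mu> (a', b') < \<mu> (a, b)"
      using finI by (simp add: \<mu>_def psubset_card_mono)
    ultimately show False by simp
  qed
  then show ?thesis using that[of a b] ab(1) by (auto simp: ok_def)
qed

text \<open>Any exchange that respects the bounds contradicts minimality. The last conclusion keeps
  of this only the exchanges that change no load; it later excludes parallel non-loops as well as
  longer cycles.\<close>

lemma good_assignment:
  fixes I :: "'i set" and S :: "'s set"
  assumes finI: "finite I" and finS: "finite S" and NS: "\<And>i. i \<in> I \<Longrightarrow> N i \<subseteq> S"
    and k: "1 \<le> k"
    and "\<And>X. X \<subseteq> I \<Longrightarrow> 2 * card X \<le> (2 * k + 1) * card (\<Union>(N ` X))"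
    and "\<And>X. X \<subseteq> I \<Longrightarrow> card X + card S \<le> card I + card (\<Union>(N ` X))"
  obtains a b where "\<And>i. i \<in> I \<Longrightarrow> a i \<in> N i \<and> b i \<in> N i"
    and "\<And>s. s \<in> S \<Longrightarrow> 2 \<le> load I a b s \<and> load I a b s \<le> 2 * k + 1"
    and "\<And>i. i \<in> I \<Longrightarrow> a i \<noteq> b i \<Longrightarrow>
      load I a b (a i) = 2 * k + 1 \<and> load I a b (b i) = 2 * k + 1"
    and "\<And>X g. X \<subseteq> I \<Longrightarrow> X \<noteq> {} \<Longrightarrow> (\<And>i. i \<in> X \<Longrightarrow> a i \<noteq> b i \<and> g i \<in> {a i, b i}) \<Longrightarrow>
      \<exists>s. load X a b s \<noteq> load X g g s"
proof -
  obtain a b where N: "\<And>i. i \<in> I \<Longrightarrow> a i \<in> N i \<and> b i \<in> N i"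
    and bounds: "\<And>s. s \<in> S \<Longrightarrow> 2 \<le> load I a b s \<and> load I a b s \<le> 2 * k + 1"
    and min: "\<And>X g. X \<subseteq> I \<Longrightarrow> X \<noteq> {} \<Longrightarrow> (\<And>i. i \<in> X \<Longrightarrow> a i \<noteq> b i \<and> g i \<in> {a i, b i}) \<Longrightarrow>
      \<exists>s\<in>S. \<not> (2 \<le> load (I - X) a b s + load X g g s \<and>
        load (I - X) a b s + load X g g s \<le> 2 * k + 1)"
    using minimal_assignment[OF finI assignment_exists[OF assms]] by blast
  have split: "load I a b s = load (I - X) a b s + load X a b s" if "X \<subseteq> I" for X s
    using load_split[OF finI that] .
  have ends: "a i \<in> S" "b i \<in> S" if "i \<in> I" for i using N NS that by blast+
  \<comment> \<open>A loop at \<open>b i\<close> in place of the non-loop \<open>i\<close> moves one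
    unit of load from \<open>a i\<close> to \<open>b i\<close>. Minimality requires
    \<open>a i\<close> to be at the lower bound or \<open>b i\<close> at the upper one; the second
    claim is the reverse move.\<close>
  have shift: "load I a b (a i) \<le> 2 \<or> 2 * k + 1 \<le> load I a b (b i)"
    "load I a b (b i) \<le> 2 \<or> 2 * k + 1 \<le> load I a b (a i)" if i: "i \<in> I" "a i \<noteq> b i" for i
  proof -
    have ls: "load I a b s = load (I - {i}) a b s + (of_bool (a i = s) + of_bool (b i = s))" for s
      using split[of "{i}" s] i(1) by simp
    obtain s where "s \<in> S" "\<not> (2 \<le> load (I - {i}) a b s + load {i} (\<lambda>_. b i) (\<lambda>_. b i) s \<and>
        load (I - {i}) a b s + load {i} (\<lambda>_. b i) (\<lambda>_. b i) s \<le> 2 * k + 1)"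
      using min[of "{i}" "\<lambda>_. b i"] i by auto
    then show "load I a b (a i) \<le> 2 \<or> 2 * k + 1 \<le> load I a b (b i)"
      using bounds[of s] ls[of s] i(2) by (auto simp: of_bool_def split: if_splits)
    obtain s where "s \<in> S" "\<not> (2 \<le> load (I - {i}) a b s + load {i} (\<lambda>_. a i) (\<lambda>_. a i) s \<and>
        load (I - {i}) a b s + load {i} (\<lambda>_. a i) (\<lambda>_. a i) s \<le> 2 * k + 1)"
      using min[of "{i}" "\<lambda>_. a i"] i by auto
    then show "load I a b (b i) \<le> 2 \<or> 2 * k + 1 \<le> load I a b (a i)"
      using bounds[of s] ls[of s] i(2) by (auto simp: of_bool_def split: if_splits)
  qed
  have same: "(load I a b (a i) = 2 \<and> load I a b (b i) = 2) \<or>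
    (load I a b (a i) = 2 * k + 1 \<and> load I a b (b i) = 2 * k + 1)" if i: "i \<in> I" "a i \<noteq> b i" for i
    using shift[OF i] bounds[OF ends(1)[OF i(1)]] bounds[OF ends(2)[OF i(1)]] k by linarith
  \<comment> \<open>Non-loops at vertices of load \<open>2\<close> form a 2-regular multigraph on
    \<open>Z\<close>. Hall's theorem picks a different incident non-loop \<open>h s\<close> for each
    \<open>s\<close> in \<open>Z\<close>; making each \<open>h s\<close> a loop at \<open>s\<close>
    keeps all loads within the bounds, a contradiction.\<close>
  have "load I a b (a j) \<noteq> 2" if j: "j \<in> I" "a j \<noteq> b j" for j
  proof
    assume j2: "load I a b (a j) = 2"
    define L where "L = {i \<in> I. a i \<noteq> b i}"
    define inc where "inc s = {i \<in> L. s \<in> {a i, b i}}" for s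
    define Z where "Z = {s \<in> S. load I a b s = 2 \<and> inc s \<noteq> {}}"
    have LI: "L \<subseteq> I" and finL: "finite L" using finI by (auto simp: L_def)
    have finZ: "finite Z" using finS by (simp add: Z_def)
    have fininc: "finite (inc s)" for s using finL by (simp add: inc_def)
    have inc2: "card (inc s) = 2" if "s \<in> Z" for s
    proof -
      have "inc s = {i \<in> I. a i \<noteq> b i \<and> s \<in> {a i, b i}}" by (auto simp: inc_def L_def)
      then have "2 = card (inc s) + 2 * card {i \<in> I. a i = b i \<and> a i = s}"
        using load_eq[OF finI, of a b s] that by (simp add: Z_def)
      moreover have "card (inc s) \<noteq> 0" using that fininc by (simp add: Z_def)
      ultimately show ?thesis by presburger
    qed
    have "\<exists>h. inj_on h Z \<and> (\<forall>s\<in>Z. h s \<in> inc s)"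
    proof (rule hall)
      fix Y assume Y: "Y \<subseteq> Z"
      have finY: "finite Y" using Y finZ finite_subset by blast
      have finU: "finite (\<Union>(inc ` Y))" using finY fininc by simp
      \<comment> \<open>Double counting: each vertex of \<open>Y\<close> lies on two non-loops, and
        each non-loop has at most two ends in \<open>Y\<close>.\<close>
      have "2 * card Y = (\<Sum>s\<in>Y. card (inc s))" using inc2 Y by (simp add: subset_eq)
      also have "\<dots> = (\<Sum>s\<in>Y. load (inc s) a b s)"
      proof (rule sum.cong)
        fix s
        have "load (inc s) a b s = card {i \<in> inc s. s \<in> {a i, b i}}"
          using fininc by (rule load_nonloops) (auto simp: inc_def L_def)
        also have "{i \<in> inc s. s \<in> {a i, b i}} = inc s" by (auto simp: inc_def)
        finally show "card (inc s) = load (inc s) a b s" by simp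
      qed simp
      also have "\<dots> \<le> (\<Sum>s\<in>Y. load (\<Union>(inc ` Y)) a b s)"
        unfolding load_def by (intro sum_mono sum_mono2 finU) auto
      also have "\<dots> = (\<Sum>i\<in>\<Union>(inc ` Y). \<Sum>s\<in>Y. of_bool (a i = s) + of_bool (b i = s))"
        unfolding load_def by (rule sum.swap)
      also have "\<dots> \<le> (\<Sum>i\<in>\<Union>(inc ` Y). 2)"
      proof (rule sum_mono)
        fix i
        show "(\<Sum>s\<in>Y. of_bool (a i = s) + of_bool (b i = s)) \<le> (2 :: nat)"
          using finY by (simp add: sum.distrib of_bool_def)
      qed
      finally show "card Y \<le> card (\<Union>(inc ` Y))" by simp
    qed (use finZ fininc in auto)
    then obtain h where h: "inj_on h Z" "\<And>s. s \<in> Z \<Longrightarrow> h s \<in> inc s" by blast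
    define g where "g = inv_into Z h"
    have gh: "g (h s) = s" if "s \<in> Z" for s using that h(1) by (simp add: g_def)
    have XI: "h ` Z \<subseteq> I" using h(2) LI by (auto simp: inc_def)
    have finX: "finite (h ` Z)" using finZ by simp
    have "j \<in> inc (a j)" using j by (auto simp: inc_def L_def)
    then have "a j \<in> Z" using j j2 ends by (auto simp: Z_def)
    moreover have "a i \<noteq> b i \<and> g i \<in> {a i, b i}" if "i \<in> h ` Z" for i
      using that h(2) gh by (fastforce simp: inc_def L_def)
    ultimately obtain s where s: "s \<in> S"
      "\<not> (2 \<le> load (I - h ` Z) a b s + load (h ` Z) g g s \<and>
        load (I - h ` Z) a b s + load (h ` Z) g g s \<le> 2 * k + 1)"
      using min[of "h ` Z" g] XI by blast
    \<comment> \<open>Each \<open>s\<close> in \<open>Z\<close> receives exactly one new loop, since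
      \<open>g\<close> inverts \<open>h\<close>.\<close>
    have new: "load (h ` Z) g g s = 2 * of_bool (s \<in> Z)"
    proof -
      have "load (h ` Z) g g s = (\<Sum>z\<in>Z. of_bool (z = s) + of_bool (z = s))"
        unfolding load_def using h(1) gh by (simp add: sum.reindex)
      also have "\<dots> = 2 * of_bool (s \<in> Z)"
        using finZ by (simp add: sum.distrib of_bool_def)
      finally show ?thesis .
    qed
    show False
    proof (cases "s \<in> Z")
      case True
      \<comment> \<open>A crude estimate is enough: the non-loop \<open>h s\<close> is removed from
        \<open>s\<close>, which leaves load at most \<open>1\<close>, so the new load is
        \<open>2\<close> or \<open>3\<close>, and \<open>3 \<le> 2 * k + 1\<close>.\<close>
      have "1 \<le> load (h ` Z) a b s"
        using h(2)[OF True] True by (intro load_pos[of _ "h s"] finX) (auto simp: inc_def)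
      then show False using s new split[OF XI, of s] True k by (simp add: Z_def)
    next
      case False
      \<comment> \<open>By \<open>same\<close>, both ends of a non-loop that meets \<open>Z\<close>
        lie in \<open>Z\<close>, so the exchange does not touch vertices outside
        \<open>Z\<close>.\<close>
      have "load (h ` Z) a b s = 0"
      proof (rule load_zero)
        fix i assume "i \<in> h ` Z"
        then obtain z where z: "z \<in> Z" "i \<in> inc z" using h(2) by blast
        then have i: "i \<in> I" "a i \<noteq> b i" and "z \<in> {a i, b i}" by (auto simp: inc_def L_def)
        then have "load I a b (a i) = 2" "load I a b (b i) = 2"
          using same[OF i] z(1) k by (auto simp: Z_def)
        moreover have "i \<in> inc (a i)" "i \<in> inc (b i)" using i by (auto simp: inc_def L_def)
        ultimately have "a i \<in> Z" "b i \<in> Z" using ends[OF i(1)] by (auto simp: Z_def)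
        then show "s \<notin> {a i, b i}" using False by blast
      qed
      then show False using s new split[OF XI, of s] bounds[OF s(1)] False by simp
    qed
  qed
  then have full: "load I a b (a i) = 2 * k + 1 \<and> load I a b (b i) = 2 * k + 1"
    if "i \<in> I" "a i \<noteq> b i" for i using same that by blast
  have "\<exists>s. load X a b s \<noteq> load X g g s"
    if X: "X \<subseteq> I" "X \<noteq> {}" "\<And>i. i \<in> X \<Longrightarrow> a i \<noteq> b i \<and> g i \<in> {a i, b i}" for X g
  proof -
    obtain s where "s \<in> S" "\<not> (2 \<le> load (I - X) a b s + load X g g s \<and>
        load (I - X) a b s + load X g g s \<le> 2 * k + 1)" using min[OF X] by blast
    then show ?thesis using bounds[of s] split[OF X(1), of s] by fastforce
  qed
  then show ?thesis using that[of a b] N bounds full by blast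
qed

section \<open>Blocks\<close>

text \<open>The multigraph with each edge \<open>i\<close> subdivided by the vertex \<open>i\<close>
  itself. For a loop the two edges coincide, which leaves one pendant edge.\<close>

definition ends_graph :: "('a \<Rightarrow> 'a) \<Rightarrow> ('a \<Rightarrow> 'a) \<Rightarrow> 'a set \<Rightarrow> 'a set \<Rightarrow> 'a ugraph" where
  "ends_graph a b K J =
     \<lparr>verts = K \<union> J, edges = (\<lambda>i. {i, a i}) ` J \<union> (\<lambda>i. {i, b i}) ` J\<rparr>"

definition ends_rel :: "('a \<Rightarrow> 'a) \<Rightarrow> ('a \<Rightarrow> 'a) \<Rightarrow> 'a set \<Rightarrow> ('a \<times> 'a) set" where
  "ends_rel a b J = {(u, v). \<exists>i\<in>J. {u, v} = {a i, b i}}"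

lemma connected_ends_graph:
  assumes "s \<in> K" and "\<And>t. t \<in> K \<Longrightarrow> (s, t) \<in> (ends_rel a b J)\<^sup>*"
    and "\<And>i. i \<in> J \<Longrightarrow> a i \<in> K"
  shows "connected_graph (ends_graph a b K J)" (is "connected_graph ?G")
proof (rule connected_graphI)
  show "s \<in> verts ?G" using assms(1) by (simp add: ends_graph_def)
  have ia: "reachable ?G i (a i)" "reachable ?G i (b i)" if "i \<in> J" for i
    using that by (auto intro!: reachable_edge simp: ends_graph_def)
  have K: "reachable ?G s t" if "t \<in> K" for t
    using assms(2)[OF that]
  proof (induction rule: rtrancl_induct)
    case (step y z)
    then obtain i where "i \<in> J" "{y, z} = {a i, b i}" by (auto simp: ends_rel_def)
    moreover from this have "reachable ?G (a i) (b i)"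
      using reachable_trans[OF reachable_sym[OF ia(1)] ia(2)] by blast
    ultimately have "reachable ?G y z"
      using reachable_sym[of ?G "a i" "b i"] by (auto simp: doubleton_eq_iff)
    then show ?case by (rule reachable_trans[OF step.IH])
  qed (rule reachable_refl)
  fix x assume "x \<in> verts ?G"
  then consider "x \<in> K" | "x \<in> J" by (auto simp: ends_graph_def)
  then show "reachable ?G s x"
  proof cases
    case 2
    then show ?thesis using reachable_trans[OF K[OF assms(3)] reachable_sym[OF ia(1)]] by blast
  qed (rule K)
qed

text \<open>A component of the multigraph with vertex set \<open>K\<close>, edge set
  \<open>J\<close> and all degrees \<open>2k + 1\<close>. Acyclicity of the non-loops is assumed in
  the form \<open>rigid\<close>, as minimality delivers it.\<close>

locale tree_block =
  fixes k :: nat and a b :: "'a \<Rightarrow> 'a" and K J :: "'a set"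
  assumes k: "1 \<le> k"
    and finK: "finite K" and finJ: "finite J" and KJ: "K \<inter> J = {}" and K_nonempty: "K \<noteq> {}"
    and ends: "\<And>i. i \<in> J \<Longrightarrow> a i \<in> K \<and> b i \<in> K"
    and conn: "\<And>s t. s \<in> K \<Longrightarrow> t \<in> K \<Longrightarrow> (s, t) \<in> (ends_rel a b J)\<^sup>*"
    and full: "\<And>s. s \<in> K \<Longrightarrow> load J a b s = 2 * k + 1"
    and rigid: "\<And>X g. X \<subseteq> J \<Longrightarrow> X \<noteq> {} \<Longrightarrow>
      (\<And>i. i \<in> X \<Longrightarrow> a i \<noteq> b i \<and> g i \<in> {a i, b i}) \<Longrightarrow> \<exists>s. load X a b s \<noteq> load X g g s"
begin

definition L :: "'a set" where "L = {i \<in> J. a i \<noteq> b i}"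
definition P :: "'a set" where "P = {i \<in> J. a i = b i}"

text \<open>
  In this choice of \<open>R\<close> all pendant edges of \<open>T\<^sub>R\<close> come from leaves of \<open>R\<close>, so that
  no new ones are attached.
\<close>

definition R :: "'a ugraph" where
  "R = \<lparr>verts = K \<union> P, edges = (\<lambda>i. {a i, b i}) ` L \<union> (\<lambda>i. {i, a i}) ` P\<rparr>"

lemma verts_R: "verts R = K \<union> P" and edges_R: "edges R = (\<lambda>i. {a i, b i}) ` L \<union> (\<lambda>i. {i, a i}) ` P"
  by (simp_all add: R_def)

lemma PD: "i \<in> P \<Longrightarrow> i \<in> J \<and> a i \<in> K \<and> b i = a i \<and> i \<notin> K"
  using ends KJ by (auto simp: P_def)

lemma LD: "i \<in> L \<Longrightarrow> i \<in> J \<and> a i \<in> K \<and> b i \<in> K \<and> a i \<noteq> b i \<and> i \<notin> K \<and> i \<notin> P"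
  using ends KJ by (auto simp: L_def P_def)

lemma P_L_edges_disjoint: "(\<lambda>i. {i, a i}) ` P \<inter> (\<lambda>i. {a i, b i}) ` L = {}"
proof (rule equals0I)
  fix e assume "e \<in> (\<lambda>i. {i, a i}) ` P \<inter> (\<lambda>i. {a i, b i}) ` L"
  then obtain i j where ij: "i \<in> P" "j \<in> L" "{i, a i} = {a j, b j}" by auto
  then have "i \<in> {a j, b j}" by blast
  then show False using PD[OF ij(1)] LD[OF ij(2)] by auto
qed

lemma edge_P_iff: assumes "i \<in> P" shows "{i, y} \<in> edges R \<longleftrightarrow> y = a i"
proof
  assume "{i, y} \<in> edges R"
  then consider j where "j \<in> L" "{i, y} = {a j, b j}" | j where "j \<in> P" "{i, y} = {j, a j}"
    unfolding edges_R by blast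
  then show "y = a i"
  proof cases
    case 1
    then have "i \<in> {a j, b j}" by blast
    then show ?thesis using PD[OF assms] LD[OF 1(1)] by auto
  next
    case 2
    then show ?thesis using PD[OF assms] PD[OF 2(1)] by (auto simp: doubleton_eq_iff)
  qed
qed (use assms in \<open>auto simp: edges_R\<close>)

lemma J_eq: "J = L \<union> P"
  by (auto simp: L_def P_def)

lemma finL: "finite L" and finP: "finite P"
  using finJ by (simp_all add: L_def P_def)

text \<open>Two parallel non-loops are a cycle of length two: turning one into a loop at each common
  end changes no load, against \<open>rigid\<close>. So the end sets represent the non-loops
  faithfully as edges of \<open>R\<close>.\<close>

lemma inj_L: "inj_on (\<lambda>i. {a i, b i}) L"
proof (rule inj_onI, rule ccontr)
  fix i j assume ij: "i \<in> L" "j \<in> L" "{a i, b i} = {a j, b j}" "i \<noteq> j"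
  define g where "g x = (if x = i then a i else b i)" for x
  have "\<exists>s. load {i, j} a b s \<noteq> load {i, j} g g s"
    by (rule rigid) (use ij LD in \<open>auto simp: g_def doubleton_eq_iff\<close>)
  then obtain s where "load {i, j} a b s \<noteq> load {i, j} g g s" by blast
  moreover have "load {i, j} a b s = load {i, j} g g s"
    using ij by (auto simp: g_def doubleton_eq_iff)
  ultimately show False by simp
qed

definition nl :: "'a \<Rightarrow> nat" where "nl s = card {i \<in> L. s \<in> {a i, b i}}"
definition lp :: "'a \<Rightarrow> nat" where "lp s = card {i \<in> P. a i = s}"

lemma nl_lp: "s \<in> K \<Longrightarrow> nl s + 2 * lp s = 2 * k + 1"
proof -
  assume s: "s \<in> K"
  have "{i \<in> J. a i \<noteq> b i \<and> s \<in> {a i, b i}} = {i \<in> L. s \<in> {a i, b i}}"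
    "{i \<in> J. a i = b i \<and> a i = s} = {i \<in> P. a i = s}"
    by (auto simp: L_def P_def)
  then show ?thesis using load_eq[OF finJ, of a b s] full[OF s] by (simp add: nl_def lp_def)
qed

lemma degree_P: assumes "i \<in> P" shows "degree R i = 1"
proof -
  have "{e \<in> edges R. i \<in> e} = {{i, a i}}"
    using assms PD LD by (auto simp: verts_R edges_R)
  then show ?thesis by (simp add: degree_def)
qed

lemma card_L_edges: "card {e \<in> (\<lambda>i. {a i, b i}) ` L. s \<in> e} = nl s"
proof -
  have "{e \<in> (\<lambda>i. {a i, b i}) ` L. s \<in> e} = (\<lambda>i. {a i, b i}) ` {i \<in> L. s \<in> {a i, b i}}" by auto
  moreover have "inj_on (\<lambda>i. {a i, b i}) {i \<in> L. s \<in> {a i, b i}}"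
    using inj_L by (rule inj_on_subset) auto
  ultimately show ?thesis by (simp add: card_image nl_def)
qed

lemma degree_K: assumes s: "s \<in> K" shows "degree R s = nl s + lp s"
proof -
  let ?A = "{e \<in> (\<lambda>i. {a i, b i}) ` L. s \<in> e}" and ?B = "(\<lambda>i. {i, a i}) ` {i \<in> P. a i = s}"
  have eq: "{e \<in> edges R. s \<in> e} = ?A \<union> ?B"
  proof -
    have "{e \<in> (\<lambda>i. {i, a i}) ` P. s \<in> e} = ?B"
      using s PD by blast
    then show ?thesis unfolding edges_R by blast
  qed
  have "?A \<inter> ?B = {}" using P_L_edges_disjoint by blast
  moreover have "finite ?A" "finite ?B" using finL finP by auto
  moreover have "inj_on (\<lambda>i. {i, a i}) {i \<in> P. a i = s}"
    by (auto simp: inj_on_def doubleton_eq_iff)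
  then have "card ?B = lp s" unfolding lp_def by (rule card_image)
  ultimately show ?thesis
    unfolding degree_def eq
    by (subst card_Un_disjoint) (simp_all add: card_L_edges)
qed

text \<open>A leaf \<open>s\<close> in \<open>K\<close> would have \<open>nl s + lp s = 1\<close>,
  hence \<open>nl s + 2 * lp s \<le> 2\<close>, which is less than \<open>2 * k + 1\<close>.\<close>

lemma leaves_R: "leaves R = P"
proof -
  have "degree R s \<noteq> 1" if "s \<in> K" for s
    using degree_K[OF that] nl_lp[OF that] k by presburger
  then show ?thesis using degree_P by (auto simp: leaves_def verts_R)
qed

lemma core_R: "core R = \<lparr>verts = K, edges = (\<lambda>i. {a i, b i}) ` L\<rparr>"
proof -
  have "verts R - leaves R = K" using PD by (auto simp: leaves_R verts_R)
  moreover have "{e \<in> edges R. e \<subseteq> K} = (\<lambda>i. {a i, b i}) ` L"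
    unfolding edges_R using PD LD by blast
  ultimately show ?thesis by (simp add: core_def induced_def)
qed

lemma degree_core: "degree (core R) s = nl s"
  unfolding core_R by (simp add: degree_def card_L_edges)

lemma adjacent_leaves_R: assumes "s \<in> K" shows "adjacent_leaves R s = lp s"
proof -
  have "{y \<in> P. {s, y} \<in> edges R} = {i \<in> P. a i = s}"
    using edge_P_iff[of _ s] by (auto simp: insert_commute)
  then show ?thesis by (simp add: adjacent_leaves_def leaves_R lp_def)
qed

text \<open>A vertex with \<open>2r + 1\<close> non-loops has exactly \<open>k - r\<close> loops, so
  the leaves of \<open>R\<close> already supply all its pendant edges.\<close>

lemma new_pendants_R: "new_pendants k R = {}"
proof -
  have "\<not> i < k - r - adjacent_leaves R x" if "x \<in> K" "nl x = 2 * r + 1" for x i r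
    using nl_lp[OF that(1)] that(2) adjacent_leaves_R[OF that(1)] by simp
  then show ?thesis
    by (auto simp: new_pendants_def degree_core) (simp add: core_R)
qed

lemma simple_R: "simple_graph R"
proof -
  have "i \<noteq> a i" if "i \<in> P" for i using PD[OF that] by auto
  then show ?thesis
    using finK finP PD LD by (auto simp: simple_graph_def verts_R edges_R)
qed

lemma connected_R: "connected_graph R"
proof -
  obtain s where s: "s \<in> K" using K_nonempty by blast
  have K: "reachable R s t" if "t \<in> K" for t
    using conn[OF s that]
  proof (induction rule: rtrancl_induct)
    case (step y z)
    then obtain i where i: "i \<in> J" "{y, z} = {a i, b i}" by (auto simp: ends_rel_def)
    have "reachable R y z"
    proof (cases "y = z")
      case False
      then have "i \<in> L" using i by (auto simp: L_def doubleton_eq_iff)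
      then have "{y, z} \<in> edges R" unfolding edges_R i(2) by blast
      then show ?thesis by (rule reachable_edge)
    qed (simp add: reachable_refl)
    then show ?case by (rule reachable_trans[OF step.IH])
  qed (rule reachable_refl)
  have "reachable R s i" if "i \<in> P" for i
  proof -
    have "{a i, i} \<in> edges R" using that by (auto simp: verts_R edges_R insert_commute)
    then show ?thesis using reachable_trans[OF K reachable_edge] PD[OF that] by blast
  qed
  then show ?thesis using K s by (intro connected_graphI[of s]) (auto simp: verts_R edges_R)
qed

text \<open>Each edge of a cycle is turned into a loop at its first vertex, which preserves the load.\<close>

lemma acyclic_R: "\<not> is_cycle R p"
proof
  assume cyc: "is_cycle R p"
  define m where "m = length p"
  \<comment> \<open>The cyclic successor, which puts the closing edge of the cycle on the same
    footing as the others.\<close>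
  define nx where "nx j = (if Suc j = m then 0 else Suc j)" for j
  have m: "3 \<le> m" and dist: "distinct p" using cyc by (auto simp: is_cycle_def m_def)
  have eq_iff: "p ! i = p ! j \<longleftrightarrow> i = j" if "i < m" "j < m" for i j
    using dist that by (simp add: nth_eq_iff_index_eq m_def)
  have nx: "nx j < m" if "j < m" for j using that by (auto simp: nx_def)
  have edge: "{p ! j, p ! nx j} \<in> edges R" if "j < m" for j
  proof (cases "Suc j = m")
    case True
    then have "j = length p - 1" and "p \<noteq> []" by (auto simp: m_def)
    then have "last p = p ! j" "hd p = p ! 0" by (simp_all add: last_conv_nth hd_conv_nth)
    then show ?thesis using cyc True by (simp add: is_cycle_def nx_def)
  next
    case False
    then show ?thesis using cyc that by (simp add: is_cycle_def nx_def m_def)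
  qed
  have edgeP: "y = a i" if "{i, y} \<in> edges R" "i \<in> P" for i y
    using that edge_P_iff by simp
  \<comment> \<open>A vertex of \<open>P\<close> has \<open>a (p ! j)\<close> as its only neighbour,
    so its predecessor and successor on the cycle would coincide.\<close>
  have notP: "p ! j \<notin> P" if j: "j < m" for j
  proof
    assume P: "p ! j \<in> P"
    define pv where "pv = (if j = 0 then m - 1 else j - 1)"
    have pv: "pv < m" "nx pv = j" using j m by (auto simp: pv_def nx_def)
    have "p ! nx j = a (p ! j)" using edgeP edge[OF j] P by blast
    moreover have "p ! pv = a (p ! j)"
      using edgeP[OF _ P, of "p ! pv"] edge[OF pv(1)] pv(2) by (simp add: insert_commute)
    ultimately have "nx j = pv" using eq_iff nx[OF j] pv(1) by metis
    then show False using j m by (auto simp: nx_def pv_def split: if_splits)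
  qed
  have "\<exists>i\<in>L. {p ! j, p ! nx j} = {a i, b i}" if "j < m" for j
    using edge[OF that] notP[OF that] notP[OF nx[OF that]] by (auto simp: verts_R edges_R doubleton_eq_iff)
  then obtain c where c: "\<And>j. j < m \<Longrightarrow> c j \<in> L"
    "\<And>j. j < m \<Longrightarrow> {p ! j, p ! nx j} = {a (c j), b (c j)}" by metis
  \<comment> \<open>Two positions could share a non-loop only by traversing it in opposite
    directions, which \<open>3 \<le> m\<close> excludes.\<close>
  have inj: "inj_on c {..<m}"
  proof (rule inj_onI)
    fix i j assume ij: "i \<in> {..<m}" "j \<in> {..<m}" "c i = c j"
    then have "{p ! i, p ! nx i} = {p ! j, p ! nx j}" using c(2) by simp
    then have "i = j \<or> (i = nx j \<and> nx i = j)"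
      using ij nx eq_iff by (auto simp: doubleton_eq_iff)
    then show "i = j" using m by (auto simp: nx_def split: if_splits)
  qed
  define g where "g i = p ! (inv_into {..<m} c i)" for i
  have g: "g (c j) = p ! j" if "j < m" for j using inj that by (simp add: g_def)
  have "bij_betw nx {..<m} {..<m}"
  proof (rule bij_betwI')
    show "nx x = nx y \<longleftrightarrow> x = y" if "x \<in> {..<m}" "y \<in> {..<m}" for x y
      using that by (auto simp: nx_def split: if_splits)
    show "\<exists>x\<in>{..<m}. y = nx x" if "y \<in> {..<m}" for y
      using that m by (intro bexI[of _ "if y = 0 then m - 1 else y - 1"]) (auto simp: nx_def)
  qed (use nx in auto)
  \<comment> \<open>Each vertex of the cycle is the second end of one cycle edge and the first end
    of another, so counting second ends is the same as counting first ends.\<close>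
  then have shift: "(\<Sum>j<m. of_bool (p ! nx j = s)) = (\<Sum>j<m. of_bool (p ! j = s) :: nat)" for s
    by (rule sum.reindex_bij_betw)
  have "load (c ` {..<m}) a b s = load (c ` {..<m}) g g s" for s
  proof -
    have "load (c ` {..<m}) a b s = (\<Sum>j<m. of_bool (a (c j) = s) + of_bool (b (c j) = s))"
      unfolding load_def using inj by (simp add: sum.reindex)
    also have "\<dots> = (\<Sum>j<m. of_bool (p ! j = s) + of_bool (p ! nx j = s))"
    proof (rule sum.cong)
      fix j assume "j \<in> {..<m}"
      then show "of_bool (a (c j) = s) + of_bool (b (c j) = s) =
          of_bool (p ! j = s) + (of_bool (p ! nx j = s) :: nat)"
        using c(2)[of j] by (auto simp: doubleton_eq_iff)
    qed simp
    also have "\<dots> = (\<Sum>j<m. of_bool (p ! j = s) + of_bool (p ! j = s))"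
      by (simp only: sum.distrib shift)
    also have "\<dots> = load (c ` {..<m}) g g s"
      unfolding load_def using inj g by (simp add: sum.reindex)
    finally show ?thesis .
  qed
  moreover have "\<exists>s. load (c ` {..<m}) a b s \<noteq> load (c ` {..<m}) g g s"
  proof (rule rigid)
    show "c ` {..<m} \<subseteq> J" using c(1) LD by blast
    show "c ` {..<m} \<noteq> {}" using m by (simp add: lessThan_empty_iff)
    fix i assume "i \<in> c ` {..<m}"
    then obtain j where "j < m" "i = c j" by blast
    then show "a i \<noteq> b i \<and> g i \<in> {a i, b i}" using c(2)[of j] c(1)[of j] LD g by auto
  qed
  ultimately show False by blast
qed

text \<open>Both degree conditions come from \<open>nl s + 2 * lp s = 2 * k + 1\<close>: it makes
  \<open>nl s\<close> odd, and it is the second condition with equality.\<close>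

lemma admissible_R: "admissible k R"
  unfolding admissible_def
proof (intro conjI ballI)
  show "tree R" using simple_R connected_R acyclic_R by (simp add: tree_def)
  fix s assume "s \<in> verts R - leaves R"
  then have s: "s \<in> K" by (auto simp: leaves_R verts_R edges_R)
  show "degree (core R) s \<in> {d. odd d \<and> 1 \<le> d \<and> d \<le> 2 * k + 1}"
  proof -
    have "odd (nl s + 2 * lp s)" unfolding nl_lp[OF s] by simp
    then have "odd (nl s)" by simp
    then show ?thesis using nl_lp[OF s] odd_pos[of "nl s"] by (auto simp: degree_core)
  qed
  show "2 * adjacent_leaves R s + degree (core R) s \<le> 2 * k + 1"
    using nl_lp[OF s] by (simp add: degree_core adjacent_leaves_R[OF s])
qed

text \<open>A non-loop corresponds to the subdivision vertex of its edge of \<open>core R\<close>;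
  vertices of \<open>K\<close> and loops correspond to themselves.\<close>

lemma iso_tree_T: "graph_iso (ends_graph a b K J) (tree_T k R)"
proof -
  define f where "f x = (if x \<in> L then Mid {a x, b x} else Orig x)" for x
  have verts_T: "verts (tree_T k R) = Orig ` (K \<union> P) \<union> (\<lambda>i. Mid {a i, b i}) ` L"
    by (auto simp: tree_T_def new_pendants_R core_R verts_R edges_R)
  have diff: "edges R - edges (core R) = (\<lambda>i. {i, a i}) ` P"
    using P_L_edges_disjoint unfolding core_R edges_R by auto
  have edges_T: "edges (tree_T k R) = (\<lambda>i. {Orig i, Orig (a i)}) ` P \<union>
      {{Orig x, Mid {a i, b i}} | x i. i \<in> L \<and> x \<in> {a i, b i}}"
  proof -
    have "{Orig ` e |e. e \<in> (\<lambda>i. {i, a i}) ` P} = (\<lambda>i. {Orig i, Orig (a i)}) ` P"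
      by (simp add: setcompr_eq_image image_image)
    moreover have "{{Orig x, Mid e} |x e. e \<in> (\<lambda>i. {a i, b i}) ` L \<and> x \<in> e} =
        {{Orig x, Mid {a i, b i}} | x i. i \<in> L \<and> x \<in> {a i, b i}}" by blast
    ultimately show ?thesis unfolding tree_T_def diff by (simp add: new_pendants_R core_R)
  qed
  have "bij_betw f (K \<union> J) (verts (tree_T k R))"
    unfolding bij_betw_def
  proof
    show "inj_on f (K \<union> J)"
    proof (rule inj_onI)
      fix x y assume "f x = f y"
      then consider "x \<in> L" "y \<in> L" "{a x, b x} = {a y, b y}" | "x = y"
        by (cases "x \<in> L"; cases "y \<in> L") (simp_all add: f_def)
      then show "x = y"
      proof cases
        case 1
        show ?thesis by (rule inj_onD[OF inj_L 1(3) 1(1,2)])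
      qed
    qed
    show "f ` (K \<union> J) = verts (tree_T k R)"
    proof -
      have "f ` (K \<union> P) = Orig ` (K \<union> P)" by (rule image_cong) (use LD in \<open>auto simp: f_def\<close>)
      moreover have "f ` L = (\<lambda>i. Mid {a i, b i}) ` L" by (rule image_cong) (simp_all add: f_def)
      moreover have "K \<union> J = (K \<union> P) \<union> L" using J_eq by blast
      ultimately show ?thesis unfolding verts_T by (simp add: image_Un)
    qed
  qed
  moreover have "{x, y} \<in> edges (ends_graph a b K J) \<longleftrightarrow> {f x, f y} \<in> edges (tree_T k R)"
    if xy: "x \<in> K \<union> J" "y \<in> K \<union> J" for x y
  proof -
    have Mid: "{Orig x, Mid {a i, b i}} \<in> edges (tree_T k R) \<longleftrightarrow> x \<in> {a i, b i}" if "i \<in> L" for x i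
      unfolding edges_T using that by (auto simp: doubleton_eq_iff)
    have Mids: "{Mid e, Mid e'} \<notin> edges (tree_T k R)" for e e'
      unfolding edges_T by (auto simp: doubleton_eq_iff)
    have Orig: "{Orig x, Orig y} \<in> edges (tree_T k R) \<longleftrightarrow>
        (x \<in> P \<and> y = a x) \<or> (y \<in> P \<and> x = a y)" for x y
    proof -
      have "{Orig x, Orig y} \<noteq> {Orig z, Mid e}" for z e by (simp add: doubleton_eq_iff)
      then have "{Orig x, Orig y} \<in> edges (tree_T k R) \<longleftrightarrow>
          (\<exists>i\<in>P. {Orig x, Orig y} = {Orig i, Orig (a i)})"
        unfolding edges_T by blast
      then show ?thesis by (simp add: doubleton_eq_iff) blast
    qed
    have block: "{x, y} \<in> edges (ends_graph a b K J) \<longleftrightarrow>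
        (x \<in> J \<and> y \<in> {a x, b x}) \<or> (y \<in> J \<and> x \<in> {a y, b y})"
      by (simp add: ends_graph_def image_iff doubleton_eq_iff) blast
    have "x \<in> L \<or> x \<in> K \<union> P" "y \<in> L \<or> y \<in> K \<union> P" using xy J_eq by auto
    then consider "x \<in> L" "y \<in> L" | "x \<in> L" "y \<in> K \<union> P" | "x \<in> K \<union> P" "y \<in> L"
      | "x \<in> K \<union> P" "y \<in> K \<union> P"
      by fast
    then show ?thesis
    proof cases
      case 1
      then show ?thesis using Mids LD[of x] LD[of y] KJ by (auto simp: block f_def)
    next
      case 2
      then have "f x = Mid {a x, b x}" "f y = Orig y" using LD[of y] by (auto simp: f_def)
      moreover have "x \<in> J" "\<not> (y \<in> J \<and> x \<in> {a y, b y})"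
        using 2 LD[of x] PD[of y] KJ by auto
      ultimately show ?thesis using Mid[OF 2(1), of y] by (auto simp: block insert_commute)
    next
      case 3
      then have "f x = Orig x" "f y = Mid {a y, b y}" using LD[of x] by (auto simp: f_def)
      moreover have "y \<in> J" "\<not> (x \<in> J \<and> y \<in> {a x, b x})"
        using 3 LD[of y] PD[of x] KJ by auto
      ultimately show ?thesis using Mid[OF 3(2), of x] by (auto simp: block)
    next
      case 4
      then have f: "f x = Orig x" "f y = Orig y" using LD[of x] LD[of y] by (auto simp: f_def)
      have J_iff: "z \<in> J \<longleftrightarrow> z \<in> P" if "z \<in> K \<union> P" for z
        using that KJ J_eq by auto
      have "b z = a z" if "z \<in> P" for z using PD[OF that] by simp
      then show ?thesis unfolding f Orig block J_iff[OF 4(1)] J_iff[OF 4(2)] by auto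
    qed
  qed
  ultimately show ?thesis unfolding graph_iso_def by (auto simp: ends_graph_def)
qed

end

section \<open>Graphs with few isolated vertices after deletions\<close>

definition isolated :: "'a ugraph \<Rightarrow> 'a set \<Rightarrow> 'a set" where
  "isolated G S = {x \<in> verts G - S. \<forall>y. {x, y} \<in> edges G \<longrightarrow> y \<in> S}"

definition nb :: "'a ugraph \<Rightarrow> 'a \<Rightarrow> 'a set" where
  "nb G x = {y. {x, y} \<in> edges G}"

lemma nb_sym: "y \<in> nb G x \<longleftrightarrow> x \<in> nb G y"
  by (simp add: nb_def insert_commute)

lemma nbD: "simple_graph G \<Longrightarrow> y \<in> nb G x \<Longrightarrow> y \<in> verts G \<and> x \<in> verts G \<and> y \<noteq> x"
  by (fastforce simp: simple_graph_def nb_def)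

lemma isolated_iff: "x \<in> isolated G S \<longleftrightarrow> x \<in> verts G \<and> x \<notin> S \<and> nb G x \<subseteq> S"
  by (auto simp: isolated_def nb_def)

lemma degree_eq_card_nb:
  assumes "simple_graph G"
  shows "degree G x = card (nb G x)"
proof -
  have "{e \<in> edges G. x \<in> e} = (\<lambda>y. {x, y}) ` nb G x"
  proof
    show "{e \<in> edges G. x \<in> e} \<subseteq> (\<lambda>y. {x, y}) ` nb G x"
    proof
      fix e assume e: "e \<in> {e \<in> edges G. x \<in> e}"
      then have "card e = 2" using assms by (simp add: simple_graph_def)
      then obtain u v where "e = {u, v}" by (auto simp: card_2_iff)
      then obtain y where "e = {x, y}" using e by auto
      then show "e \<in> (\<lambda>y. {x, y}) ` nb G x" using e by (auto simp: nb_def)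
    qed
  qed (auto simp: nb_def)
  moreover have "inj_on (\<lambda>y. {x, y}) (nb G x)" by (auto simp: inj_on_def doubleton_eq_iff)
  ultimately show ?thesis by (simp add: degree_def card_image)
qed

text \<open>Hall's condition is needed only for independent sets: a vertex of \<open>X\<close> with
  a neighbour in \<open>X\<close> is itself a neighbour of \<open>X\<close>, and the remaining set
  \<open>X0\<close> has all its neighbours in \<open>W\<close> outside \<open>X\<close>. The
  resulting injection of \<open>W\<close> into itself is a permutation along edges.\<close>

lemma tileable_perfect_2_matching:
  assumes G: "simple_graph G" and "2 \<le> k" and "star ` {1..k} \<subseteq> \<H>" and W: "W \<subseteq> verts G"
    and few: "\<And>X Q. X \<subseteq> W \<Longrightarrow> Q \<subseteq> W \<Longrightarrow> X \<inter> Q = {} \<Longrightarrow> (\<And>x. x \<in> X \<Longrightarrow> nb G x \<inter> W \<subseteq> Q) \<Longrightarrow>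
      card X \<le> card Q"
  shows "tileable \<H> (edges G) W"
proof -
  have finW: "finite W" using G W finite_subset by (auto simp: simple_graph_def)
  have "\<exists>f. inj_on f W \<and> (\<forall>x\<in>W. f x \<in> nb G x \<inter> W)"
  proof (rule hall)
    fix X assume X: "X \<subseteq> W"
    define X0 where "X0 = {x \<in> X. nb G x \<inter> X = {}}"
    define Q where "Q = \<Union>((\<lambda>x. nb G x \<inter> W) ` X0)"
    have X0X: "X0 \<subseteq> X" by (auto simp: X0_def)
    have QX: "Q \<inter> X = {}" by (auto simp: Q_def X0_def)
    have "card X0 \<le> card Q"
      by (rule few) (use X X0X QX in \<open>auto simp: Q_def\<close>)
    moreover have "card X = card X0 + card (X - X0)"
      using X0X X finW by (metis card_Diff_subset card_mono finite_subset le_add_diff_inverse)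
    moreover have "card (Q \<union> (X - X0)) = card Q + card (X - X0)"
      using QX X finW by (intro card_Un_disjoint) (auto simp: Q_def intro: finite_subset[of _ W])
    moreover have "card (Q \<union> (X - X0)) \<le> card (\<Union>x\<in>X. nb G x \<inter> W)"
    proof (rule card_mono)
      show "finite (\<Union>x\<in>X. nb G x \<inter> W)" by (rule finite_subset[OF _ finW]) auto
      have "X - X0 \<subseteq> (\<Union>x\<in>X. nb G x \<inter> W)"
      proof
        fix x assume x: "x \<in> X - X0"
        then obtain y where "y \<in> nb G x" "y \<in> X" by (auto simp: X0_def)
        then show "x \<in> (\<Union>x\<in>X. nb G x \<inter> W)" using x X nb_sym[of y G x] by auto
      qed
      then show "Q \<union> (X - X0) \<subseteq> (\<Union>x\<in>X. nb G x \<inter> W)"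
        using X0X by (auto simp: Q_def)
    qed
    ultimately show "card X \<le> card (\<Union>x\<in>X. nb G x \<inter> W)" by linarith
  qed (use finW in auto)
  then obtain f where f: "inj_on f W" "\<And>x. x \<in> W \<Longrightarrow> f x \<in> nb G x \<inter> W" by blast
  define \<sigma> where "\<sigma> x = (if x \<in> W then f x else x)" for x
  have "f ` W = W" using f finW by (intro endo_inj_surj) auto
  then have "bij_betw \<sigma> W W"
    using f(1) by (simp add: bij_betw_def \<sigma>_def inj_on_def)
  then have "\<sigma> permutes W"
    by (rule bij_imp_permutes) (simp add: \<sigma>_def)
  moreover have "{x, \<sigma> x} \<in> edges G \<and> \<sigma> x \<noteq> x" if "x \<in> W" for x
    using f(2)[OF that] nbD[OF G, of "f x" x] that by (auto simp: \<sigma>_def nb_def)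
  ultimately show ?thesis
    using tileable_permutation[OF assms(3,2) finW] by blast
qed

section \<open>From assignments to tilings\<close>

lemma ends_relD:
  assumes "(y, z) \<in> ends_rel a b J"
  obtains i where "i \<in> J" "y = a i \<and> z = b i \<or> y = b i \<and> z = a i"
  using assms by (auto simp: ends_rel_def doubleton_eq_iff)

text \<open>By \<open>full\<close>, non-loops join only vertices of load \<open>2k + 1\<close>. So
  either all of \<open>K\<close> has this load and the block is a tree of the family, or
  \<open>s\<close> carries only loops and the block is a star. Vertices are natural numbers so that
  the block itself can be the member of \<open>family_T\<close>.\<close>

lemma ends_tile:
  fixes E :: "nat set set"
  assumes k: "1 \<le> k" and finI: "finite I" and finS: "finite S" and SI: "S \<inter> I = {}"
    and ends: "\<And>i. i \<in> I \<Longrightarrow> a i \<in> S \<and> b i \<in> S"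
    and E: "\<And>i. i \<in> I \<Longrightarrow> {i, a i} \<in> E \<and> {i, b i} \<in> E"
    and bounds: "\<And>s. s \<in> S \<Longrightarrow> 2 \<le> load I a b s \<and> load I a b s \<le> 2 * k + 1"
    and full: "\<And>i. i \<in> I \<Longrightarrow> a i \<noteq> b i \<Longrightarrow>
      load I a b (a i) = 2 * k + 1 \<and> load I a b (b i) = 2 * k + 1"
    and rigid: "\<And>X g. X \<subseteq> I \<Longrightarrow> X \<noteq> {} \<Longrightarrow> (\<And>i. i \<in> X \<Longrightarrow> a i \<noteq> b i \<and> g i \<in> {a i, b i}) \<Longrightarrow>
      \<exists>s. load X a b s \<noteq> load X g g s"
    and s: "s \<in> S"
    and K_def: "K = {t. (s, t) \<in> (ends_rel a b I)\<^sup>*}" and J_def: "J = {i \<in> I. a i \<in> K}"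
  shows "ends_graph a b K J \<in> tiles (star ` {1..k} \<union> family_T k) E"
proof -
  have sK: "s \<in> K" by (simp add: K_def)
  have K_step: "z \<in> K" if "y \<in> K" "(y, z) \<in> ends_rel a b I" for y z
    using that by (auto simp: K_def)
  have rel: "(a i, b i) \<in> ends_rel a b I" "(b i, a i) \<in> ends_rel a b I" if "i \<in> I" for i
    using that by (auto simp: ends_rel_def)
  have JI: "J \<subseteq> I" and finJ: "finite J" using finI by (auto simp: J_def)
  have endsK: "a i \<in> K \<and> b i \<in> K" if "i \<in> J" for i
    using that K_step rel(1) by (auto simp: J_def)
  have bJ: "i \<in> J" if "i \<in> I" "b i \<in> K" for i
    using that K_step rel(2) by (auto simp: J_def)
  have "t \<in> S" if "(s, t) \<in> (ends_rel a b I)\<^sup>*" for t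
    using that
  proof (induction rule: rtrancl_induct)
    case (step y z)
    then show ?case using ends by (metis ends_relD)
  qed (rule s)
  then have KS: "K \<subseteq> S" by (auto simp: K_def)
  have KJ: "K \<inter> J = {}" using KS JI SI by blast
  have conn_s: "(s, t) \<in> (ends_rel a b J)\<^sup>*" if "t \<in> K" for t
    using that[unfolded K_def, simplified]
  proof (induction rule: rtrancl_induct)
    case (step y z)
    have "y \<in> K" using step.hyps(1) by (simp add: K_def)
    obtain i where i: "i \<in> I" "y = a i \<and> z = b i \<or> y = b i \<and> z = a i"
      using step.hyps(2) by (rule ends_relD)
    then have "i \<in> J" using \<open>y \<in> K\<close> bJ by (auto simp: J_def)
    then have "(y, z) \<in> ends_rel a b J" using i(2) by (auto simp: ends_rel_def)
    then show ?case using step.IH by (rule rtrancl_into_rtrancl[rotated])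
  qed simp
  have connected: "connected_graph (ends_graph a b K J)"
    using sK conn_s endsK by (intro connected_ends_graph) auto
  have sub: "edges (ends_graph a b K J) \<subseteq> E"
    using E JI by (auto simp: ends_graph_def)
  have sub': "edges (ends_graph a b K J) \<subseteq> Pow (verts (ends_graph a b K J))"
    using endsK by (auto simp: ends_graph_def)
  show ?thesis
  proof (cases "load I a b s = 2 * k + 1")
    case True
    have loadK: "load I a b t = 2 * k + 1" if "t \<in> K" for t
      using that[unfolded K_def, simplified]
    proof (induction rule: rtrancl_induct)
      case (step y z)
      obtain i where i: "i \<in> I" "y = a i \<and> z = b i \<or> y = b i \<and> z = a i"
        using step.hyps(2) by (rule ends_relD)
      then show ?case using full[OF i(1)] step.IH by (cases "a i = b i") auto
    qed (rule True)
    have sym: "sym (ends_rel a b J)" by (auto simp: sym_def ends_rel_def insert_commute)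
    interpret tree_block k a b K J
    proof
      show "finite K" using KS finS by (rule finite_subset)
      show "K \<noteq> {}" using sK by blast
      show "(x, t) \<in> (ends_rel a b J)\<^sup>*" if "x \<in> K" "t \<in> K" for x t
        using conn_s[OF that(1)] conn_s[OF that(2)] sym_rtrancl[OF sym]
        by (meson rtrancl_trans symD)
      show "load J a b t = 2 * k + 1" if t: "t \<in> K" for t
      proof -
        have "load (I - J) a b t = 0"
          by (rule load_zero) (use t bJ in \<open>auto simp: J_def\<close>)
        then show ?thesis using load_split[OF finI JI, of a b t] loadK[OF t] by simp
      qed
      show "\<exists>s. load X a b s \<noteq> load X g g s"
        if "X \<subseteq> J" "X \<noteq> {}" "\<And>i. i \<in> X \<Longrightarrow> a i \<noteq> b i \<and> g i \<in> {a i, b i}" for X g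
        using rigid[of X g] that JI by blast
    qed (use k finJ KJ endsK in auto)
    have "i \<noteq> a i \<and> i \<noteq> b i" if "i \<in> J" for i using endsK[OF that] KJ that by auto
    then have "simple_graph (ends_graph a b K J)"
      using finK finJ endsK by (auto simp: simple_graph_def ends_graph_def)
    then have "ends_graph a b K J \<in> family_T k"
      using admissible_R iso_tree_T by (auto simp: family_T_def)
    then show ?thesis
      using connected sub sub' graph_iso_refl[of "ends_graph a b K J"] unfolding tiles_def by blast
  next
    case False
    have loop: "b i = a i" if "i \<in> I" "a i = s \<or> b i = s" for i
      using full[OF that(1)] that(2) False by metis
    have "t = s" if "t \<in> K" for t
      using that[unfolded K_def, simplified]
    proof (induction rule: rtrancl_induct)
      case (step y z)
      then show ?case using loop by (metis ends_relD)
    qed simp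
    then have K: "K = {s}" using sK by blast
    have J: "a i = s" "b i = s" if "i \<in> J" for i using endsK[OF that] K by auto
    have "a i = b i" if "i \<in> I" "s \<in> {a i, b i}" for i using loop[of i] that by auto
    then have nonloops: "{i \<in> I. a i \<noteq> b i \<and> s \<in> {a i, b i}} = {}" by blast
    have loops: "{i \<in> I. a i = b i \<and> a i = s} = J"
    proof
      show "{i \<in> I. a i = b i \<and> a i = s} \<subseteq> J" using K by (auto simp: J_def)
      show "J \<subseteq> {i \<in> I. a i = b i \<and> a i = s}" using J JI by fastforce
    qed
    have "load I a b s = 2 * card J" unfolding load_eq[OF finI] nonloops loops by simp
    \<comment> \<open>From \<open>2 \<le> 2 * card J \<le> 2 * k + 1\<close>; the odd upper bound
      rounds down to \<open>k\<close>.\<close>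
    then have cardJ: "card J \<in> {1..k}" using bounds[OF s] by auto
    have "ends_graph a b K J = star_on s J"
    proof -
      have "(\<lambda>i. {i, a i}) ` J = (\<lambda>i. {s, i}) ` J" "(\<lambda>i. {i, b i}) ` J = (\<lambda>i. {s, i}) ` J"
        using J by (auto simp: insert_commute intro!: image_cong)
      then show ?thesis by (simp add: ends_graph_def star_on_def K)
    qed
    moreover have "star_on s J \<in> tiles (star ` {1..k} \<union> family_T k) E"
    proof (rule star_on_tile[OF finJ _ cardJ])
      show "s \<notin> J" using KJ sK by blast
      show "{s, i} \<in> E" if "i \<in> J" for i
        using E[of i] J[OF that] JI that by (auto simp: insert_commute)
    qed simp
    ultimately show ?thesis by simp
  qed
qed

text \<open>The components of the multigraph partition \<open>S\<close>, and each \<open>i\<close>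
  joins the component containing both of its ends.\<close>

lemma tileable_ends:
  fixes E :: "nat set set"
  assumes "1 \<le> k" and "finite I" and "finite S" and SI: "S \<inter> I = {}"
    and ends: "\<And>i. i \<in> I \<Longrightarrow> a i \<in> S \<and> b i \<in> S"
    and "\<And>i. i \<in> I \<Longrightarrow> {i, a i} \<in> E \<and> {i, b i} \<in> E"
    and "\<And>s. s \<in> S \<Longrightarrow> 2 \<le> load I a b s \<and> load I a b s \<le> 2 * k + 1"
    and "\<And>i. i \<in> I \<Longrightarrow> a i \<noteq> b i \<Longrightarrow>
      load I a b (a i) = 2 * k + 1 \<and> load I a b (b i) = 2 * k + 1"
    and "\<And>X g. X \<subseteq> I \<Longrightarrow> X \<noteq> {} \<Longrightarrow> (\<And>i. i \<in> X \<Longrightarrow> a i \<noteq> b i \<and> g i \<in> {a i, b i}) \<Longrightarrow>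
      \<exists>s. load X a b s \<noteq> load X g g s"
  shows "tileable (star ` {1..k} \<union> family_T k) E (S \<union> I)"
proof -
  define K where "K s = {t. (s, t) \<in> (ends_rel a b I)\<^sup>*}" for s
  define J where "J s = {i \<in> I. a i \<in> K s}" for s
  define B where "B s = ends_graph a b (K s) (J s)" for s
  have tile: "B s \<in> tiles (star ` {1..k} \<union> family_T k) E" if "s \<in> S" for s
    unfolding B_def using assms that K_def J_def by (rule ends_tile)
  have refl: "s \<in> K s" for s by (simp add: K_def)
  have "sym ((ends_rel a b I)\<^sup>*)"
    by (rule sym_rtrancl) (auto simp: sym_def ends_rel_def insert_commute)
  then have cls: "K s = K t" if "x \<in> K s" "x \<in> K t" for s t x
    using that unfolding K_def by (blast dest: symD intro: rtrancl_trans)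
  have KS: "K s \<subseteq> S" if "s \<in> S" for s
  proof -
    have "t \<in> S" if "(s, t) \<in> (ends_rel a b I)\<^sup>*" for t
      using that
    proof (induction rule: rtrancl_induct)
      case (step y z)
      then show ?case using ends by (metis ends_relD)
    qed (rule \<open>s \<in> S\<close>)
    then show ?thesis by (auto simp: K_def)
  qed
  have verts: "verts (B s) = K s \<union> J s" for s by (simp add: B_def ends_graph_def)
  show ?thesis
    unfolding tileable_def
  proof (intro exI[of _ "B ` S"] conjI ballI impI)
    show "B ` S \<subseteq> tiles (star ` {1..k} \<union> family_T k) E" using tile by blast
    show "\<Union> (verts ` B ` S) = S \<union> I"
    proof
      show "\<Union> (verts ` B ` S) \<subseteq> S \<union> I" using KS by (auto simp: verts J_def)
      have "i \<in> \<Union> (verts ` B ` S)" if "i \<in> I" for i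
        using that ends[OF that] refl[of "a i"] by (auto simp: verts J_def)
      then show "S \<union> I \<subseteq> \<Union> (verts ` B ` S)" using refl by (auto simp: verts)
    qed
    fix C D assume "C \<in> B ` S" "D \<in> B ` S" "C \<noteq> D"
    then obtain s t where st: "C = B s" "D = B t" "s \<in> S" "t \<in> S" by blast
    \<comment> \<open>\<open>B s\<close> depends on \<open>s\<close> only through its component
      \<open>K s\<close>.\<close>
    with \<open>C \<noteq> D\<close> have "K s \<noteq> K t" by (auto simp: B_def J_def)
    then have "K s \<inter> K t = {}" using cls by blast
    moreover have "J s \<inter> J t = {}" using calculation by (auto simp: J_def)
    moreover have "K s \<inter> J t = {}" "J s \<inter> K t = {}"
      using KS[OF st(3)] KS[OF st(4)] SI by (auto simp: J_def)
    ultimately show "verts C \<inter> verts D = {}" by (auto simp: st verts)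
  qed
qed

text \<open>Maximality of \<open>d S\<close> is used twice: against \<open>S \<union> Q\<close> for
  the tiling of \<open>W\<close>, and against the neighbourhood of \<open>X\<close> for
  \<open>lower\<close>. The isolated-vertex bound enters through \<open>upper\<close>.\<close>

lemma tileable_if_isolated_bound_nat:
  fixes G :: "nat ugraph"
  assumes k: "2 \<le> k" and G: "simple_graph G"
    and bound: "\<And>S. S \<subseteq> verts G \<Longrightarrow> 2 * card (isolated G S) \<le> (2 * k + 1) * card S"
  shows "tileable (star ` {1..k} \<union> family_T k) (edges G) (verts G)"
proof -
  have finV: "finite (verts G)" using G by (simp add: simple_graph_def)
  \<comment> \<open>Integer-valued, since the difference may be negative.\<close>
  define d where "d S = int (card (isolated G S)) - int (card S)" for S
  have finD: "finite (d ` Pow (verts G))" and "d ` Pow (verts G) \<noteq> {}" using finV by auto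
  then have "Max (d ` Pow (verts G)) \<in> d ` Pow (verts G)" by (rule Max_in)
  then obtain S where S: "S \<subseteq> verts G" "d S = Max (d ` Pow (verts G))" by auto
  have max: "d T \<le> d S" if "T \<subseteq> verts G" for T
    using Max_ge[OF finD, of "d T"] that S(2) by auto
  define I where "I = isolated G S"
  define W where "W = verts G - S - I"
  have IV: "I \<subseteq> verts G" and SI: "S \<inter> I = {}" and IS: "\<And>i. i \<in> I \<Longrightarrow> nb G i \<subseteq> S"
    by (auto simp: I_def isolated_iff)
  have finI: "finite I" and finS: "finite S" and finW: "finite W"
    using finV IV S(1) finite_subset by (auto simp: W_def)
  have finiso: "finite (isolated G T)" for T
    by (rule finite_subset[OF _ finV]) (auto simp: isolated_def)
  have "tileable (star ` {1..k} \<union> family_T k) (edges G) W"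
  proof (rule tileable_perfect_2_matching[OF G k])
    fix X Q assume X: "X \<subseteq> W" and Q: "Q \<subseteq> W" and XQ: "X \<inter> Q = {}"
      and nbX: "\<And>x. x \<in> X \<Longrightarrow> nb G x \<inter> W \<subseteq> Q"
    \<comment> \<open>Deleting \<open>Q\<close> as well isolates \<open>X\<close> and keeps
      \<open>I\<close> isolated, so \<open>card Q < card X\<close> would contradict the choice of
      \<open>S\<close>.\<close>
    have "I \<union> X \<subseteq> isolated G (S \<union> Q)"
    proof
      fix x assume "x \<in> I \<union> X"
      then show "x \<in> isolated G (S \<union> Q)"
      proof
        assume "x \<in> I"
        then show ?thesis using IS Q IV SI by (auto simp: isolated_iff W_def)
      next
        assume x: "x \<in> X"
        have "y \<in> S \<union> Q" if y: "y \<in> nb G x" for y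
        proof (rule ccontr)
          assume neg: "y \<notin> S \<union> Q"
          then have "y \<in> I" using nbX[OF x] y nbD[OF G y] by (auto simp: W_def)
          then have "x \<in> S" using IS[of y] y nb_sym[of y G x] by auto
          then show False using x X by (auto simp: W_def)
        qed
        then show ?thesis using x X XQ by (auto simp: isolated_iff W_def)
      qed
    qed
    then have "card (I \<union> X) \<le> card (isolated G (S \<union> Q))" by (rule card_mono[OF finiso])
    moreover have "card (I \<union> X) = card I + card X"
      using X finI finW by (intro card_Un_disjoint) (auto simp: W_def intro: finite_subset)
    moreover have "card (S \<union> Q) = card S + card Q"
      using Q finS finW by (intro card_Un_disjoint) (auto simp: W_def intro: finite_subset)
    moreover have "d (S \<union> Q) \<le> d S"
      using S(1) Q by (intro max) (auto simp: W_def)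
    ultimately show "card X \<le> card Q" by (simp add: d_def I_def)
  qed (auto simp: W_def)
  moreover have "tileable (star ` {1..k} \<union> family_T k) (edges G) (S \<union> I)"
  proof -
    have iso: "X \<subseteq> isolated G (\<Union>(nb G ` X))" and sub: "\<Union>(nb G ` X) \<subseteq> S" if X: "X \<subseteq> I" for X
    proof -
      show sub: "\<Union>(nb G ` X) \<subseteq> S" using X IS by blast
      show "X \<subseteq> isolated G (\<Union>(nb G ` X))"
      proof
        fix x assume x: "x \<in> X"
        then have "x \<in> verts G" "x \<notin> S" using X IV SI by blast+
        moreover have "nb G x \<subseteq> \<Union>(nb G ` X)" using x by (rule UN_upper)
        ultimately show "x \<in> isolated G (\<Union>(nb G ` X))"
          using sub unfolding isolated_iff by blast
      qed
    qed
    have card_iso: "card X \<le> card (isolated G (\<Union>(nb G ` X)))" if "X \<subseteq> I" for X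
      using iso[OF that] by (rule card_mono[OF finiso])
    have upper: "2 * card X \<le> (2 * k + 1) * card (\<Union>(nb G ` X))" if X: "X \<subseteq> I" for X
    proof -
      have "2 * card X \<le> 2 * card (isolated G (\<Union>(nb G ` X)))" using card_iso[OF X] by simp
      also have "\<dots> \<le> (2 * k + 1) * card (\<Union>(nb G ` X))"
        using sub[OF X] S(1) by (intro bound) (rule order_trans)
      finally show ?thesis .
    qed
    have lower: "card X + card S \<le> card I + card (\<Union>(nb G ` X))" if X: "X \<subseteq> I" for X
      using max[OF order_trans[OF sub[OF X] S(1)]] card_iso[OF X] by (simp add: d_def I_def)
    obtain a b where ab: "\<And>i. i \<in> I \<Longrightarrow> a i \<in> nb G i \<and> b i \<in> nb G i"
      "\<And>s. s \<in> S \<Longrightarrow> 2 \<le> load I a b s \<and> load I a b s \<le> 2 * k + 1"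
      "\<And>i. i \<in> I \<Longrightarrow> a i \<noteq> b i \<Longrightarrow>
        load I a b (a i) = 2 * k + 1 \<and> load I a b (b i) = 2 * k + 1"
      "\<And>X g. X \<subseteq> I \<Longrightarrow> X \<noteq> {} \<Longrightarrow> (\<And>i. i \<in> X \<Longrightarrow> a i \<noteq> b i \<and> g i \<in> {a i, b i}) \<Longrightarrow>
        \<exists>s. load X a b s \<noteq> load X g g s"
      by (rule good_assignment[OF finI finS IS _ upper lower]) (use k in auto)
    show ?thesis
    proof (rule tileable_ends)
      show "1 \<le> k" using k by simp
      show "a i \<in> S \<and> b i \<in> S" if "i \<in> I" for i using ab(1)[OF that] IS[OF that] by blast
      show "{i, a i} \<in> edges G \<and> {i, b i} \<in> edges G" if "i \<in> I" for i
        using ab(1)[OF that] by (simp add: nb_def)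
    qed (use finI finS SI ab in auto)
  qed
  ultimately have "tileable (star ` {1..k} \<union> family_T k) (edges G) (W \<union> (S \<union> I))"
    by (rule tileable_Un) (auto simp: W_def)
  moreover have "W \<union> (S \<union> I) = verts G" using S(1) IV by (auto simp: W_def)
  ultimately show ?thesis by simp
qed

text \<open>\<open>family_T\<close> lives on natural numbers, so \<open>G\<close> is renamed by an
  injection into \<open>nat\<close>, tiled there, and renamed back.\<close>

lemma tileable_if_isolated_bound:
  fixes G :: "'a ugraph"
  assumes "2 \<le> k" and G: "simple_graph G"
    and bound: "\<And>S. S \<subseteq> verts G \<Longrightarrow> 2 * card (isolated G S) \<le> (2 * k + 1) * card S"
  shows "tileable (star ` {1..k} \<union> family_T k) (edges G) (verts G)"
proof -
  have finV: "finite (verts G)" using G by (simp add: simple_graph_def)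
  then obtain h :: "'a \<Rightarrow> nat" where h: "inj_on h (verts G)"
    by (meson finite_imp_inj_to_nat_seg)
  define H where "H = map_graph h G"
  have edge: "e \<subseteq> verts G" "card e = 2" if "e \<in> edges G" for e
    using G that by (simp_all add: simple_graph_def)
  have "simple_graph H"
    using finV edge inj_on_subset[OF h] by (auto simp: H_def map_graph_def simple_graph_def card_image)
  moreover have "2 * card (isolated H S) \<le> (2 * k + 1) * card S" if "S \<subseteq> verts H" for S
  proof -
    obtain T where T: "T \<subseteq> verts G" "S = h ` T"
      using \<open>S \<subseteq> verts H\<close> by (auto simp: H_def map_graph_def elim: subset_imageE)
    have "isolated H S \<subseteq> h ` isolated G T"
    proof
      fix x' assume x': "x' \<in> isolated H S"
      then obtain x where x: "x \<in> verts G" "x' = h x" "x \<notin> T"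
        by (auto simp: isolated_def H_def map_graph_def T(2))
      have "y \<in> T" if y: "{x, y} \<in> edges G" for y
      proof -
        have "{h x, h y} \<in> edges H"
          using imageI[OF y, of "image h"] by (simp add: H_def map_graph_def)
        then have "h y \<in> h ` T" using x' x(2) T(2) by (simp add: isolated_def)
        then show ?thesis using inj_on_image_mem_iff[OF h _ T(1), of y] edge(1)[OF y] by simp
      qed
      then show "x' \<in> h ` isolated G T" using x by (auto simp: isolated_def)
    qed
    moreover have fin: "finite (isolated G T)"
      by (rule finite_subset[OF _ finV]) (auto simp: isolated_def)
    ultimately have "card (isolated H S) \<le> card (isolated G T)"
      by (meson card_image_le card_mono finite_imageI order_trans)
    moreover have "card S = card T"
      using T inj_on_subset[OF h] by (simp add: card_image)
    ultimately show ?thesis using bound[OF T(1)] by simp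
  qed
  ultimately have "tileable (star ` {1..k} \<union> family_T k) (edges H) (verts H)"
    using tileable_if_isolated_bound_nat[OF assms(1)] by blast
  moreover define f where "f = inv_into (verts G) h"
  have "inj_on f (verts H)"
    unfolding f_def H_def map_graph_def by (simp add: inj_on_inv_into)
  ultimately have "tileable (star ` {1..k} \<union> family_T k) ((`) f ` edges H) (f ` verts H)"
    by (rule tileable_image)
  moreover have image: "f ` h ` U = U" if "U \<subseteq> verts G" for U
    unfolding f_def using h that by (rule inv_into_image_cancel)
  then have "f ` verts H = verts G" by (simp add: H_def map_graph_def)
  moreover have "(`) f ` edges H = edges G"
    using image edge(1) by (simp add: H_def map_graph_def image_image)
  ultimately show ?thesis by simp
qed

text \<open>
  All vertices isolated by deleting \<open>S\<close> have their neighbours in \<open>S\<close>, hence degree at most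
  \<open>|S|\<close>; too many of them would leave \<open>|S| < 2n / (2k + 3)\<close>.
\<close>

lemma isolated_bound:
  fixes G :: "'a ugraph"
  assumes G: "simple_graph G" and "min_degree G \<ge> 1"
    and deg: "\<And>S. independent_set G S \<Longrightarrow>
      card S = nat \<lfloor>(real k + 1 / 2) * real (min_degree G)\<rfloor> + 1 \<Longrightarrow>
      real (Max (degree G ` S)) \<ge> 2 * real (card (verts G)) / (2 * real k + 3)"
    and S: "S \<subseteq> verts G"
  shows "2 * card (isolated G S) \<le> (2 * k + 1) * card S"
proof (rule ccontr)
  assume neg: "\<not> ?thesis"
  define \<delta> where "\<delta> = min_degree G"
  \<comment> \<open>The floor of \<open>(k + 1/2) * \<delta>\<close>, written as a natural-number
    quotient.\<close>
  define m where "m = (2 * k + 1) * \<delta> div 2"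
  have finV: "finite (verts G)" using G by (simp add: simple_graph_def)
  have finS: "finite S" using S finV by (rule finite_subset)
  have isoV: "isolated G S \<subseteq> verts G - S" by (auto simp: isolated_def)
  have finI: "finite (isolated G S)" using isoV finV by (meson finite_Diff finite_subset)
  have degS: "degree G x \<le> card S" if "x \<in> isolated G S" for x
    using that finS by (auto simp: degree_eq_card_nb[OF G] isolated_iff intro: card_mono)
  obtain x where x: "x \<in> isolated G S" using neg by fastforce
  then have "\<delta> \<le> degree G x"
    using finV isoV by (auto simp: \<delta>_def min_degree_def)
  then have \<delta>S: "\<delta> \<le> card S" using degS[OF x] by simp
  have "(real k + 1 / 2) * real \<delta> = real ((2 * k + 1) * \<delta>) / real 2"
    by (simp add: field_simps)
  then have m: "nat \<lfloor>(real k + 1 / 2) * real \<delta>\<rfloor> = m"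
    by (simp only: floor_divide_of_nat_eq m_def nat_int)
  have "(2 * k + 1) * \<delta> \<le> (2 * k + 1) * card S" using \<delta>S by (rule mult_le_mono2)
  \<comment> \<open>The negated bound is strict, and \<open>\<delta> \<le> card S\<close>; this
    yields the extra \<open>1\<close> needed for the size of the independent set.\<close>
  then have "m + 1 \<le> card (isolated G S)" using neg by (simp add: m_def)
  then obtain T where T: "T \<subseteq> isolated G S" "card T = m + 1"
    by (meson obtain_subset_with_card_n)
  have "independent_set G T"
    using T(1) G by (auto simp: independent_set_def indep_def isolated_def)
  then have "real (Max (degree G ` T)) \<ge> 2 * real (card (verts G)) / (2 * real k + 3)"
    using deg T(2) m by (simp add: \<delta>_def)
  moreover have "Max (degree G ` T) \<le> card S"
  proof (rule Max.boundedI)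
    show "finite (degree G ` T)" using T(1) finI by (meson finite_imageI finite_subset)
    show "degree G ` T \<noteq> {}" using T(2) by auto
  qed (use degS T(1) in auto)
  ultimately have "2 * real (card (verts G)) / (2 * real k + 3) \<le> real (card S)"
    by (meson of_nat_mono order_trans)
  then have "2 * real (card (verts G)) \<le> real (card S) * (2 * real k + 3)"
    by (simp add: divide_le_eq)
  then have "real (2 * card (verts G)) \<le> real (card S * (2 * k + 3))" by simp
  then have "2 * card (verts G) \<le> card S * (2 * k + 3)" by (simp only: of_nat_le_iff)
  moreover have "card S + card (isolated G S) \<le> card (verts G)"
  proof -
    have "card S + card (isolated G S) = card (S \<union> isolated G S)"
      using finS finI isoV by (subst card_Un_disjoint) auto
    also have "\<dots> \<le> card (verts G)" using finV S isoV by (intro card_mono) auto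
    finally show ?thesis .
  qed
  \<comment> \<open>With \<open>s = card S\<close> and \<open>i = card (isolated G S)\<close>:
    \<open>2s + 2i \<le> 2 * card (verts G) \<le> (2k + 3)s\<close>, hence
    \<open>2i \<le> (2k + 1)s\<close>, against \<open>neg\<close>.\<close>
  ultimately show False using neg by (simp add: algebra_simps)
qed

theorem theorem1p4:
  fixes G :: "'a ugraph" and k n \<delta> :: nat
  assumes "k \<ge> 2"
    and "simple_graph G" and "verts G \<noteq> {}"
    and "n = card (verts G)"
    and "\<delta> = min_degree G" and "\<delta> \<ge> 1"
    and "\<And>S. independent_set G S \<Longrightarrow>
           card S = nat \<lfloor>(real k + 1 / 2) * real \<delta>\<rfloor> + 1 \<Longrightarrow>
           real (Max (degree G ` S)) \<ge> 2 * real n / (2 * real k + 3)"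
  shows "\<exists>F. is_factor (star ` {1..k} \<union> family_T k) G F"
proof (rule factor_if_tileable)
  show "tileable (star ` {1..k} \<union> family_T k) (edges G) (verts G)"
  proof (rule tileable_if_isolated_bound)
    show "2 * card (isolated G S) \<le> (2 * k + 1) * card S" if "S \<subseteq> verts G" for S
      by (rule isolated_bound) (use assms that in auto)
  qed (use assms in auto)
qed (rule assms)

end
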